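(* Let $\mathfrak g$ be a simply-laced simple Lie algebra of rank $r$, $k\ge1$, $\lambda=\sum_\alpha l_\alpha\omega_\alpha$ a dominant integral weight, and $\mathbf n=\{n_{\alpha,i}\}_{1\le\alpha\le r,1\le i\le k}$ non-negative integers. Then $$\mathrm{PS}_{u_1,\dots,u_r}\ \varphi_{k+1}\big(Z^{(k)}_{\lambda;\mathbf n}(\mathbf u)\big)=\mathrm{PS}_{u_1,\dots,u_r}\ \varphi_{k+1}\big(Z^{(k)}_{\lambda;\mathbf n}(\mathbf u)^{[1,\dots,1]}\big).$$
   Context: $C$ is the Cartan matrix of $\mathfrak g$, $I_r=\{1,\dots,r\}$. Formal variables $\mathbf u=\{u_\alpha;u_{\alpha,i}\mid \alpha\in I_r,i\ge1\}$. For $\mathbf m=\{m_{\alpha,i}\ge 0\}_{1\le\alpha\le r,1\le i\le k}$ set $$q_\alpha=l_\alpha+\sum_{j=1}^k\sum_{\beta\in I_r}j(C_{\alpha,\beta}m_{\beta,j}-\delta_{\alpha,\beta}n_{\beta,j}),\qquad q_{\alpha,i}=l_\alpha+\sum_{j=1}^{k-i}\sum_{\beta\in I_r}j(C_{\alpha,\beta}m_{\beta,i+j}-\delta_{\alpha,\beta}n_{\beta,i+j}),$$ and $$Z^{(k)}_{\lambda;\mathbf n}(\mathbf u)=\sum_{\mathbf m\in\mathbb Z_{\ge0}^{r\times k}}\prod_{\alpha=1}^r u_\alpha^{q_\alpha}\prod_{i=1}^k\binom{m_{\alpha,i}+q_{\alpha,i}}{m_{\alpha,i}}u_{\alpha,i}^{q_{\alpha,i}},$$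 with $\binom{m+p}{m}=\frac{(p+m)\cdots(p+1)}{m!}$ for all $p\in\mathbb Z$. For given values of all $q_\alpha$ only finitely many $\mathbf m$ contribute, so this is a Laurent series in the $u_\alpha$ with Laurent polynomial coefficients in the $u_{\alpha,i}$. For $K=(k_1,\dots,k_r)\in\mathbb N^r$, $Z^{(k)}_{\lambda;\mathbf n}(\mathbf u)^{[K]}$ is the same sum restricted to those $\mathbf m$ with $q_{\alpha,j}\ge0$ for all $\alpha$ and all $j\ge k_\alpha$ ($j\le k$). $\varphi_{k+1}$ evaluates $u_{\alpha,l}=1$ for all $\alpha$ and all $l<k+1$. $\mathrm{PS}_{u_1,\dots,u_r}$ denotes the part of a Laurent series in $u_1,\dots,u_r$ consisting of the monomials in which every $u_\alpha$ has non-negative exponent. *)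

theory Defs
  imports Complex_Main "HOL-Library.Poly_Mapping"
begin

section \<open>Complex simple Lie algebras and their Cartan matrices\<close>

text \<open>
  The Lie algebra is the whole type \<open>'g\<close>, and \<open>B\<close> is an arbitrary vector space basis; it is
  used only to write down traces, which do not depend on it.
\<close>

locale complex_lie_algebra = finite_dimensional_vector_space scale B
  for scale :: "complex \<Rightarrow> 'g::ab_group_add \<Rightarrow> 'g" and B :: "'g set" +
  fixes brk :: "'g \<Rightarrow> 'g \<Rightarrow> 'g"
  assumes brk_linear_right: "Vector_Spaces.linear scale scale (\<lambda>y. brk x y)"
    and brk_linear_left: "Vector_Spaces.linear scale scale (\<lambda>x. brk x y)"
    and brk_self: "brk x x = 0"
    and jacobi: "brk x (brk y z) + brk y (brk z x) + brk z (brk x y) = 0"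
begin

definition lie_ideal :: "'g set \<Rightarrow> bool" where
  "lie_ideal J \<longleftrightarrow> subspace J \<and> (\<forall>x. \<forall>y\<in>J. brk x y \<in> J)"

definition trace :: "('g \<Rightarrow> 'g) \<Rightarrow> complex" where
  "trace f = (\<Sum>b\<in>B. representation B (f b) b)"

definition killing_form :: "'g \<Rightarrow> 'g \<Rightarrow> complex" where
  "killing_form x y = trace (\<lambda>z. brk x (brk y z))"

definition weight_space :: "'g set \<Rightarrow> ('g \<Rightarrow> complex) \<Rightarrow> 'g set" where
  "weight_space H \<mu> = {x. \<forall>h\<in>H. brk h x = scale (\<mu> h) x}"

text \<open>
  A Cartan subalgebra of a complex semisimple Lie algebra: an abelian, self-centralizing subalgebra
  \<open>H\<close> whose adjoint action is simultaneously diagonalizable.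
\<close>

definition cartan_subalgebra :: "'g set \<Rightarrow> bool" where
  "cartan_subalgebra H \<longleftrightarrow>
     subspace H \<and>
     (\<forall>x\<in>H. \<forall>y\<in>H. brk x y = 0) \<and>
     (\<forall>x. (\<forall>h\<in>H. brk h x = 0) \<longrightarrow> x \<in> H) \<and>
     span (\<Union>\<mu>. weight_space H \<mu>) = UNIV"

text \<open>
  Functionals on \<open>H\<close> are represented by functions on \<open>'g\<close>, of which only the values on \<open>H\<close>
  matter. Linearity on \<open>H\<close> of a root is automatic, as its weight space is nonzero.
\<close>

definition is_root :: "'g set \<Rightarrow> ('g \<Rightarrow> complex) \<Rightarrow> bool" where
  "is_root H \<beta> \<longleftrightarrow> (\<exists>h\<in>H. \<beta> h \<noteq> 0) \<and> weight_space H \<beta> \<noteq> {0}"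

definition simple_roots :: "'g set \<Rightarrow> ('r::finite \<Rightarrow> 'g \<Rightarrow> complex) \<Rightarrow> bool" where
  "simple_roots H a \<longleftrightarrow>
     (\<forall>\<alpha>. is_root H (a \<alpha>)) \<and>
     (\<forall>c. (\<forall>h\<in>H. (\<Sum>\<alpha>\<in>UNIV. c \<alpha> * a \<alpha> h) = 0) \<longrightarrow> (\<forall>\<alpha>. c \<alpha> = 0)) \<and>
     (\<forall>\<beta>. is_root H \<beta> \<longrightarrow>
        (\<exists>c :: 'r \<Rightarrow> nat. (\<forall>h\<in>H. \<beta> h = (\<Sum>\<alpha>\<in>UNIV. of_nat (c \<alpha>) * a \<alpha> h)) \<or>
                        (\<forall>h\<in>H. \<beta> h = - (\<Sum>\<alpha>\<in>UNIV. of_nat (c \<alpha>) * a \<alpha> h))))"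

text \<open>
  The entries are \<open>2 (a \<alpha>, a \<beta>) / (a \<alpha>, a \<alpha>)\<close>, where the Killing form is transported to the dual of \<open>H\<close>
  through the elements \<open>t \<alpha> \<in> H\<close> representing the simple roots. For a simple Lie algebra the \<open>t \<alpha>\<close>
  exist, are unique, and satisfy \<open>(a \<alpha>, a \<alpha>) \<noteq> 0\<close>.
  The index type \<open>'r\<close> plays the role of \<open>{1, \<dots>, r}\<close>, the rank being its cardinality.
\<close>

definition is_cartan_matrix :: "('r::finite \<Rightarrow> 'r \<Rightarrow> int) \<Rightarrow> bool" where
  "is_cartan_matrix C \<longleftrightarrow>
     (\<exists>H a t. cartan_subalgebra H \<and> simple_roots H a \<and>
        (\<forall>\<alpha>. t \<alpha> \<in> H \<and> (\<forall>h\<in>H. killing_form (t \<alpha>) h = a \<alpha> h)) \<and>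
        (\<forall>\<alpha>. killing_form (t \<alpha>) (t \<alpha>) \<noteq> 0) \<and>
        (\<forall>\<alpha> \<beta>. of_int (C \<alpha> \<beta>) =
           2 * killing_form (t \<alpha>) (t \<beta>) / killing_form (t \<alpha>) (t \<alpha>)))"

end

locale simple_lie_algebra = complex_lie_algebra +
  assumes non_abelian: "\<exists>x y. brk x y \<noteq> 0"
    and no_proper_ideal: "lie_ideal J \<Longrightarrow> J = {0} \<or> J = UNIV"

text \<open>Simply-laced: the Dynkin diagram has no multiple edges.\<close>

definition simply_laced :: "('r \<Rightarrow> 'r \<Rightarrow> int) \<Rightarrow> bool" where
  "simply_laced C \<longleftrightarrow> (\<forall>\<alpha> \<beta>. \<alpha> \<noteq> \<beta> \<longrightarrow> C \<alpha> \<beta> \<in> {0, -1})"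


section \<open>Laurent series in the \<open>u\<^sub>\<alpha>\<close> with Laurent polynomial coefficients in the \<open>u\<^sub>\<alpha>\<^sub>,\<^sub>i\<close>\<close>

text \<open>
  Laurent polynomials in the \<open>u\<^sub>\<alpha>\<^sub>,\<^sub>i\<close> over the integers form the group algebra of the finitely supported
  exponent vectors. A series in the \<open>u\<^sub>\<alpha>\<close> is the family of its coefficients, indexed by integral
  exponents.
\<close>

type_synonym 'r laurent_poly = "('r \<times> nat \<Rightarrow>\<^sub>0 int) \<Rightarrow>\<^sub>0 int"
type_synonym 'r laurent_series = "('r \<Rightarrow> int) \<Rightarrow> 'r laurent_poly"

definition u_pow :: "'r \<Rightarrow> nat \<Rightarrow> int \<Rightarrow> 'r laurent_poly" where
  "u_pow \<alpha> i e = Poly_Mapping.single (Poly_Mapping.single (\<alpha>, i) e) 1"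

definition eval_ones_poly :: "nat \<Rightarrow> 'r laurent_poly \<Rightarrow> 'r laurent_poly" where
  "eval_ones_poly j p =
     (\<Sum>b\<in>Poly_Mapping.keys p. of_int (Poly_Mapping.lookup p b) *
        (\<Prod>(\<alpha>, l)\<in>Poly_Mapping.keys b. if l < j then 1 else u_pow \<alpha> l (Poly_Mapping.lookup b (\<alpha>, l))))"

text \<open>The evaluation \<open>\<phi>\<^sub>j\<close>, setting \<open>u\<^sub>\<alpha>\<^sub>,\<^sub>l = 1\<close> for all \<open>\<alpha>\<close> and all \<open>l < j\<close>.\<close>

definition eval_ones :: "nat \<Rightarrow> 'r laurent_series \<Rightarrow> 'r laurent_series" where
  "eval_ones j Z = (\<lambda>e. eval_ones_poly j (Z e))"

definition PS :: "'r laurent_series \<Rightarrow> 'r laurent_series" where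
  "PS Z = (\<lambda>e. if \<forall>\<alpha>. 0 \<le> e \<alpha> then Z e else 0)"


section \<open>The generating functions\<close>

text \<open>
  The binomial coefficient \<open>m + p\<close> over \<open>m\<close>, for every integer \<open>p\<close>; the division is exact.
\<close>

definition binom :: "nat \<Rightarrow> int \<Rightarrow> int" where
  "binom m p = (\<Prod>s=1..m. p + int s) div fact m"

definition q_tot :: "('r::finite \<Rightarrow> 'r \<Rightarrow> int) \<Rightarrow> ('r \<Rightarrow> nat) \<Rightarrow> ('r \<Rightarrow> nat \<Rightarrow> nat) \<Rightarrow> nat \<Rightarrow>
    ('r \<Rightarrow> nat \<Rightarrow> nat) \<Rightarrow> 'r \<Rightarrow> int" where
  "q_tot C l n k m \<alpha> = int (l \<alpha>) +
     (\<Sum>j=1..k. \<Sum>\<beta>\<in>UNIV. int j *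
        (C \<alpha> \<beta> * int (m \<beta> j) - (if \<alpha> = \<beta> then int (n \<beta> j) else 0)))"

definition q_part :: "('r::finite \<Rightarrow> 'r \<Rightarrow> int) \<Rightarrow> ('r \<Rightarrow> nat) \<Rightarrow> ('r \<Rightarrow> nat \<Rightarrow> nat) \<Rightarrow> nat \<Rightarrow>
    ('r \<Rightarrow> nat \<Rightarrow> nat) \<Rightarrow> 'r \<Rightarrow> nat \<Rightarrow> int" where
  "q_part C l n k m \<alpha> i = int (l \<alpha>) +
     (\<Sum>j=1..k-i. \<Sum>\<beta>\<in>UNIV. int j *
        (C \<alpha> \<beta> * int (m \<beta> (i + j)) - (if \<alpha> = \<beta> then int (n \<beta> (i + j)) else 0)))"

definition summation_range :: "nat \<Rightarrow> ('r \<Rightarrow> nat \<Rightarrow> nat) set" where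
  "summation_range k = {m. \<forall>\<alpha> i. i \<notin> {1..k} \<longrightarrow> m \<alpha> i = 0}"

definition summand :: "('r::finite \<Rightarrow> 'r \<Rightarrow> int) \<Rightarrow> ('r \<Rightarrow> nat) \<Rightarrow> ('r \<Rightarrow> nat \<Rightarrow> nat) \<Rightarrow> nat \<Rightarrow>
    ('r \<Rightarrow> nat \<Rightarrow> nat) \<Rightarrow> 'r laurent_poly" where
  "summand C l n k m =
     (\<Prod>\<alpha>\<in>UNIV. \<Prod>i=1..k.
        of_int (binom (m \<alpha> i) (q_part C l n k m \<alpha> i)) *
        u_pow \<alpha> i (q_part C l n k m \<alpha> i))"

text \<open>
  The coefficient of \<open>\<Prod>\<^sub>\<alpha> u\<^sub>\<alpha> ^ e \<alpha>\<close> collects the \<open>m\<close> with \<open>q\<^sub>\<alpha> = e \<alpha>\<close>; there are finitely many of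
  these, because the Cartan matrix is invertible.
\<close>

definition Z_restricted_to :: "(('r \<Rightarrow> nat \<Rightarrow> nat) \<Rightarrow> bool) \<Rightarrow> ('r::finite \<Rightarrow> 'r \<Rightarrow> int) \<Rightarrow>
    ('r \<Rightarrow> nat) \<Rightarrow> ('r \<Rightarrow> nat \<Rightarrow> nat) \<Rightarrow> nat \<Rightarrow> 'r laurent_series" where
  "Z_restricted_to P C l n k =
     (\<lambda>e. \<Sum>m | m \<in> summation_range k \<and> P m \<and> (\<forall>\<alpha>. q_tot C l n k m \<alpha> = e \<alpha>). summand C l n k m)"

definition Z_full :: "('r::finite \<Rightarrow> 'r \<Rightarrow> int) \<Rightarrow> ('r \<Rightarrow> nat) \<Rightarrow> ('r \<Rightarrow> nat \<Rightarrow> nat) \<Rightarrow> nat \<Rightarrow>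
    'r laurent_series" where
  "Z_full C l n k = Z_restricted_to (\<lambda>m. True) C l n k"

definition Z_restr :: "('r \<Rightarrow> nat) \<Rightarrow> ('r::finite \<Rightarrow> 'r \<Rightarrow> int) \<Rightarrow> ('r \<Rightarrow> nat) \<Rightarrow>
    ('r \<Rightarrow> nat \<Rightarrow> nat) \<Rightarrow> nat \<Rightarrow> 'r laurent_series" where
  "Z_restr K C l n k =
     Z_restricted_to (\<lambda>m. \<forall>\<alpha> j. K \<alpha> \<le> j \<and> j \<le> k \<longrightarrow> 0 \<le> q_part C l n k m \<alpha> j) C l n k"

end

theory Submission
  imports Defs "HOL-Computational_Algebra.Formal_Power_Series" "HOL-Library.Function_Algebras"
begin

text \<open>
  By the binomial series, summing over the \<open>m\<^sub>\<alpha>\<^sub>,\<^sub>i\<close> with \<open>i \<le> j\<close> for fixed \<open>q\<^sub>j\<^sub>+\<^sub>1\<close>, \<open>q\<^sub>j\<close> gives the product over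
  \<open>\<alpha>\<close> of \<open>Q\<^sub>\<alpha>\<^sub>,\<^sub>1\<close>, the power \<open>- q\<^sub>\<alpha>\<^sub>,\<^sub>j - 1\<close> of \<open>Q\<^sub>\<alpha>\<^sub>,\<^sub>j\<^sub>+\<^sub>1\<close>, the power \<open>q\<^sub>\<alpha>\<^sub>,\<^sub>j\<^sub>+\<^sub>1 + 1\<close> of \<open>Q\<^sub>\<alpha>\<^sub>,\<^sub>j\<close> and the powers
  \<open>n\<^sub>\<alpha>\<^sub>,\<^sub>i\<close> of \<open>Q\<^sub>\<alpha>\<^sub>,\<^sub>i\<close>, \<open>i \<le> j\<close>, where \<open>Q\<close> solves the Q-system with \<open>Q\<^sub>\<alpha>\<^sub>,\<^sub>0 = 1\<close> and \<open>Q\<^sub>\<alpha>\<^sub>,\<^sub>1 = u\<^sub>\<alpha>\<^sup>-\<^sup>1\<close>. By a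
  Laurent phenomenon argument no \<open>Q\<^sub>\<beta>\<^sub>,\<^sub>j\<close> contains a positive power of any \<open>u\<^sub>\<alpha>\<close>, and neither does its inverse if
  \<open>\<beta> \<noteq> \<alpha>\<close>. If \<open>q\<^sub>j\<^sub>+\<^sub>1 \<ge> 0\<close> and \<open>q\<^sub>\<alpha>\<^sub>,\<^sub>j < 0\<close>, then only nonnegative powers of the \<open>Q\<^sub>\<alpha>\<^sub>,\<^sub>i\<close> occur, and the factor
  \<open>Q\<^sub>\<alpha>\<^sub>,\<^sub>1\<close> makes all exponents of \<open>u\<^sub>\<alpha>\<close> negative. So the terms for which some \<open>q\<^sub>\<alpha>\<^sub>,\<^sub>j\<close> is negative,
  collected according to the largest such \<open>j\<close>, contribute nothing to the nonnegative exponents.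
\<close>

section \<open>Integrality and Pascal's rule for the binomial coefficients\<close>

lemma rising_prod_diff:
  fixes p :: int
  shows "(\<Prod>s=1..Suc m. p + int s) - (\<Prod>s=1..Suc m. (p - 1) + int s)
    = int (Suc m) * (\<Prod>s=1..m. p + int s)"
proof -
  have "(\<Prod>s=1..Suc m. (p - 1) + int s) = (\<Prod>s=0..m. p + int s)"
    using prod.shift_bounds_cl_Suc_ivl[of "\<lambda>s. (p - 1) + int s" 0 m] by simp
  also have "\<dots> = p * (\<Prod>s=1..m. p + int s)"
    by (simp add: prod.atLeast_Suc_atMost)
  finally show ?thesis by (simp add: algebra_simps)
qed

lemma rising_prod_neg_1: "(\<Prod>s=1..Suc m. - 1 + int s) = 0"
  by (rule prod_zero) (auto intro: bexI[of _ 1])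

text \<open>Outer induction on \<open>m\<close>, inner induction on \<open>p\<close> in both
  directions from \<open>-1\<close>, where a factor is zero. Moving \<open>p\<close> by one changes
  the product by \<open>Suc m\<close> times a shorter product, which \<open>fact (Suc m)\<close>
  divides by the outer hypothesis.\<close>

lemma fact_dvd_rising_prod: "(fact m :: int) dvd (\<Prod>s=1..m. p + int s)"
proof (induction m arbitrary: p)
  case (Suc m)
  have step: "(fact (Suc m) :: int) dvd (\<Prod>s=1..Suc m. p + int s) - (\<Prod>s=1..Suc m. (p - 1) + int s)"
    for p unfolding rising_prod_diff using Suc.IH[of p] by (simp del: of_nat_Suc add: mult_dvd_mono)
  show ?case
  proof (induction p rule: int_induct[where k = "-1"])
    case base
    show ?case unfolding rising_prod_neg_1 by simp
  next
    case (step1 i)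
    then show ?case using step[of "i + 1"] by (simp add: dvd_diff_left_iff del: prod.cl_ivl_Suc fact_Suc)
  next
    case (step2 i)
    then show ?case using step[of i] by (simp add: dvd_diff_right_iff del: prod.cl_ivl_Suc fact_Suc)
  qed
qed simp

lemma fact_mult_binom: "fact m * binom m p = (\<Prod>s=1..m. p + int s)"
  unfolding binom_def using fact_dvd_rising_prod by simp

lemma binom_0 [simp]: "binom 0 p = 1"
  by (simp add: binom_def)

lemma binom_Suc: "binom (Suc m) p = binom (Suc m) (p - 1) + binom m p"
proof -
  have "fact (Suc m) * binom (Suc m) p = fact (Suc m) * binom (Suc m) (p - 1) + int (Suc m) * (fact m * binom m p)"
    using rising_prod_diff[of p m] unfolding fact_mult_binom by linarith
  also have "\<dots> = fact (Suc m) * (binom (Suc m) (p - 1) + binom m p)"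
    by (simp add: algebra_simps)
  finally show ?thesis by simp
qed

lemma binom_neg_1: "binom (Suc m) (- 1) = 0"
  unfolding binom_def rising_prod_neg_1 by simp

section \<open>Integer powers of units and the binomial series\<close>

text \<open>Meaningful for units only. The series below have Laurent polynomial coefficients, so
  inverses are taken in a commutative ring and not in a field.\<close>

definition unit_inv :: "'a::comm_ring_1 \<Rightarrow> 'a" where
  "unit_inv x = (SOME y. x * y = 1)"

definition ipow :: "'a::comm_ring_1 \<Rightarrow> int \<Rightarrow> 'a" where
  "ipow x e = (if 0 \<le> e then x ^ nat e else unit_inv x ^ nat (- e))"

lemma unit_inv: "x dvd 1 \<Longrightarrow> x * unit_inv x = 1"
  unfolding unit_inv_def dvd_def by (rule someI_ex) metis

lemma ipow_0 [simp]: "ipow x 0 = 1"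
  by (simp add: ipow_def)

lemma ipow_1 [simp]: "ipow x 1 = x"
  by (simp add: ipow_def)

lemma ipow_of_nat: "ipow x (int m) = x ^ m"
  by (simp add: ipow_def)

lemma ipow_plus_1:
  assumes "x dvd 1"
  shows "ipow x (e + 1) = ipow x e * x"
proof (cases "0 \<le> e")
  case True
  then show ?thesis by (simp add: ipow_def nat_add_distrib)
next
  case False
  then have "nat (- e) = Suc (nat (- e - 1))" by simp
  then have "ipow x e * x = unit_inv x ^ nat (- e - 1) * (x * unit_inv x)"
    using False by (simp add: ipow_def)
  then show ?thesis using False unit_inv[OF assms] by (cases "e = - 1") (auto simp: ipow_def)
qed

lemma ipow_minus_1:
  assumes "x dvd 1"
  shows "ipow x (e - 1) * x = ipow x e"
  using ipow_plus_1[OF assms, of "e - 1"] by simp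

lemma unit_cancel_right:
  fixes x :: "'a::comm_ring_1"
  assumes "x dvd 1" "a * x = b * x"
  shows "a = b"
proof -
  have "a * (x * unit_inv x) = b * (x * unit_inv x)"
    using assms(2) by (simp flip: mult.assoc)
  then show ?thesis by (simp add: unit_inv[OF assms(1)])
qed

lemma ipow_add:
  assumes "x dvd 1"
  shows "ipow x (a + b) = ipow x a * ipow x b"
proof (induction b rule: int_induct[where k = 0])
  case (step1 i)
  then show ?case
    by (simp add: ipow_plus_1[OF assms] mult.assoc flip: add.assoc)
next
  case (step2 i)
  have "ipow x (a + (i - 1)) * x = ipow x a * ipow x (i - 1) * x"
    using step2 ipow_minus_1[OF assms, of "a + i"] ipow_minus_1[OF assms, of i]
    by (simp add: mult.assoc add_diff_eq)
  then show ?case by (rule unit_cancel_right[OF assms])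
qed simp

lemma ipow_uminus_cancel: "x dvd 1 \<Longrightarrow> ipow x a * ipow x (- a) = 1"
  using ipow_add[of x a "- a"] by simp

lemma ipow_unit: "x dvd 1 \<Longrightarrow> ipow x a dvd 1"
  using ipow_uminus_cancel[of x a] by (metis dvd_triv_left)

lemma ipow_mult_base:
  assumes "x dvd 1" "y dvd 1"
  shows "ipow (x * y) a = ipow x a * ipow y a"
proof -
  have xy: "x * y dvd 1" using assms by (metis mult_dvd_mono mult_1)
  show ?thesis
  proof (induction a rule: int_induct[where k = 0])
    case (step1 i)
    then show ?case by (simp add: ipow_plus_1 assms xy mult_ac)
  next
    case (step2 i)
    have "ipow (x * y) (i - 1) * (x * y) = (ipow x (i - 1) * x) * (ipow y (i - 1) * y)"
      using step2 by (simp only: ipow_minus_1 assms xy)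
    then have "ipow (x * y) (i - 1) * (x * y) = ipow x (i - 1) * ipow y (i - 1) * (x * y)"
      by (simp add: mult_ac)
    then show ?case by (rule unit_cancel_right[OF xy])
  qed simp
qed

lemma ipow_mult_nat:
  assumes "x dvd 1"
  shows "ipow x (a * int m) = ipow x a ^ m"
  by (induction m) (simp_all add: algebra_simps ipow_add[OF assms])

lemma ipow_ipow:
  assumes "x dvd 1"
  shows "ipow (ipow x a) b = ipow x (a * b)"
proof (induction b rule: int_induct[where k = 0])
  case (step1 i)
  then show ?case by (simp add: ipow_plus_1 ipow_unit assms ipow_add distrib_left)
next
  case (step2 i)
  have "ipow (ipow x a) (i - 1) * ipow x a = ipow x (a * (i - 1)) * ipow x a"
    using step2 by (simp add: ipow_minus_1 ipow_unit assms right_diff_distrib flip: ipow_add)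
  then show ?case by (rule unit_cancel_right[OF ipow_unit[OF assms]])
qed simp

lemma ipow_sum:
  assumes "x dvd 1"
  shows "ipow x (\<Sum>i\<in>A. f i) = (\<Prod>i\<in>A. ipow x (f i))"
  by (induction A rule: infinite_finite_induct) (simp_all add: ipow_add[OF assms])

lemma fps_unitI:
  fixes f :: "'a::comm_ring_1 fps"
  assumes "fps_nth f 0 dvd 1"
  shows "f dvd 1"
proof -
  obtain y where "fps_nth f 0 * y = 1" using assms by (metis dvdE)
  then have "f * fps_right_inverse f y = 1" by (rule fps_right_inverse)
  then show ?thesis by (metis dvd_triv_left)
qed

lemma X_power_dvd_nth:
  fixes f :: "'a::comm_ring_1 fps"
  assumes "fps_X ^ j dvd f" "i < j"
  shows "fps_nth f i = 0"
  using assms by (auto simp: dvd_def fps_X_power_mult_nth)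

text \<open>The expansion of the power \<open>- b - 1\<close> of \<open>1 - T\<close>, cut off after
  \<open>T ^ N\<close>. By Pascal's rule, multiplication by \<open>1 - T\<close> lowers
  \<open>b\<close> by one up to a multiple of \<open>T ^ Suc N\<close>, and for
  \<open>b = - 1\<close> the sum is 1. Congruences modulo a power of \<open>fps_X\<close> replace
  infinite sums.\<close>

lemma binom_series:
  fixes T :: "'a::comm_ring_1 fps"
  assumes "fps_X dvd T"
  shows "fps_X ^ Suc N dvd (\<Sum>i\<le>N. of_int (binom i b) * T ^ i) - ipow (1 - T) (- b - 1)"
proof -
  define P where "P b = (\<Sum>i\<le>N. of_int (binom i b) * T ^ i)" for b
  have XT: "fps_X ^ Suc N dvd T ^ Suc N" using assms by (rule dvd_power_same)
  have unit: "1 - T dvd 1"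
    using X_power_dvd_nth[of 1 T 0] assms by (intro fps_unitI) simp
  have step: "(1 - T) * P b = P (b - 1) - of_int (binom N b) * T ^ Suc N" for b
    unfolding P_def
  proof (induction N)
    case (Suc N)
    then show ?case by (simp add: algebra_simps binom_Suc[of N b])
  qed (simp add: algebra_simps)
  have "fps_X ^ Suc N dvd P b - ipow (1 - T) (- b - 1)"
  proof (induction b rule: int_induct[where k = "- 1"])
    case base
    have "P (- 1) = (\<Sum>i\<le>N. if i = 0 then 1 else 0)"
      unfolding P_def by (intro sum.cong refl) (auto simp: gr0_conv_Suc binom_neg_1)
    then show ?case by simp
  next
    case (step1 i)
    have "(P (i + 1) - ipow (1 - T) (- (i + 1) - 1)) * (1 - T)
        = (1 - T) * P (i + 1) - ipow (1 - T) (- i - 1 - 1) * (1 - T)"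
      by (simp add: algebra_simps)
    also have "\<dots> = (P i - ipow (1 - T) (- i - 1)) - of_int (binom N (i + 1)) * T ^ Suc N"
      unfolding step ipow_minus_1[OF unit] by simp
    also have "fps_X ^ Suc N dvd \<dots>"
      by (intro dvd_diff[OF step1(2)] dvd_mult XT)
    finally have "fps_X ^ Suc N dvd (P (i + 1) - ipow (1 - T) (- (i + 1) - 1)) * (1 - T) * unit_inv (1 - T)"
      by (rule dvd_mult2)
    then show ?case by (simp add: mult.assoc unit_inv[OF unit])
  next
    case (step2 i)
    have "P (i - 1) - ipow (1 - T) (- (i - 1) - 1)
        = (P i - ipow (1 - T) (- i - 1)) * (1 - T) + of_int (binom N i) * T ^ Suc N"
    proof -
      have "(P i - ipow (1 - T) (- i - 1)) * (1 - T) = (1 - T) * P i - ipow (1 - T) (- i - 1) * (1 - T)"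
        by (simp add: algebra_simps)
      then show ?thesis unfolding step ipow_minus_1[OF unit] by simp
    qed
    also have "fps_X ^ Suc N dvd \<dots>"
      by (intro dvd_add[OF dvd_mult2[OF step2(2)]] dvd_mult XT)
    finally show ?case .
  qed
  then show ?thesis by (simp add: P_def)
qed

section \<open>The Q-system\<close>

text \<open>Monomials in the \<open>u\<^sub>\<alpha>\<close> alone, since the evaluation sets every
  \<open>u\<^sub>\<alpha>\<^sub>,\<^sub>i\<close> that occurs to 1. Exponent vectors are functions
  added pointwise, as in \<open>laurent_series\<close>.\<close>

definition monom :: "('r \<Rightarrow> int) \<Rightarrow> ('r \<Rightarrow> int) \<Rightarrow>\<^sub>0 int" where
  "monom e = Poly_Mapping.single e 1"

lemma monom_mult: "monom e * monom e' = monom (e + e')"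
  by (simp add: monom_def mult_single)

lemma monom_zero: "monom 0 = 1"
  by (simp add: monom_def)

lemma monom_zero' [simp]: "monom (\<lambda>_. 0) = 1"
  using monom_zero by (simp add: zero_fun_def)

lemma monom_unit: "monom e dvd 1"
  using monom_mult[of e "- e"] by (metis dvd_triv_left monom_zero right_minus)

definition axis :: "'r \<Rightarrow> int \<Rightarrow> 'r \<Rightarrow> int" where
  "axis \<alpha> c = (\<lambda>\<beta>. if \<beta> = \<alpha> then c else 0)"

lemma axis_add: "axis \<alpha> c + axis \<alpha> d = axis \<alpha> (c + d)" and axis_zero: "axis \<alpha> 0 = 0"
  by (auto simp: axis_def fun_eq_iff)

lemma sum_axis: "(\<Sum>\<alpha>\<in>UNIV. axis \<alpha> (b \<alpha>)) = (b :: 'r::finite \<Rightarrow> int)"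
proof
  fix \<beta>
  have "(\<Sum>\<alpha>\<in>A. axis \<alpha> (b \<alpha>)) \<beta> = (\<Sum>\<alpha>\<in>A. axis \<alpha> (b \<alpha>) \<beta>)" if "finite A" for A
    using that by induction simp_all
  then show "(\<Sum>\<alpha>\<in>UNIV. axis \<alpha> (b \<alpha>)) \<beta> = b \<beta>"
    by (simp add: axis_def)
qed

lemma monom_axis_power: "monom (axis \<alpha> c) ^ j = monom (axis \<alpha> (c * int j))"
  by (induction j) (simp_all add: axis_zero monom_zero monom_mult axis_add algebra_simps)

section \<open>The subrings without positive powers of \<open>u\<^sub>\<alpha>\<close>\<close>

definition nonpos_poly :: "'r \<Rightarrow> (('r \<Rightarrow> int) \<Rightarrow>\<^sub>0 int) set" where
  "nonpos_poly \<alpha> = {p. \<forall>e\<in>Poly_Mapping.keys p. e \<alpha> \<le> 0}"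

definition nonpos_series :: "'r \<Rightarrow> (('r \<Rightarrow> int) \<Rightarrow>\<^sub>0 int) fps set" where
  "nonpos_series \<alpha> = {f. \<forall>d. fps_nth f d \<in> nonpos_poly \<alpha>}"

lemma nonpos_poly_monom: "e \<alpha> \<le> 0 \<Longrightarrow> monom e \<in> nonpos_poly \<alpha>"
  by (simp add: nonpos_poly_def monom_def)

lemma nonpos_poly_0: "0 \<in> nonpos_poly \<alpha>" and nonpos_poly_1: "1 \<in> nonpos_poly \<alpha>"
  by (simp_all add: nonpos_poly_def)

lemma nonpos_poly_diff: "p \<in> nonpos_poly \<alpha> \<Longrightarrow> q \<in> nonpos_poly \<alpha> \<Longrightarrow> p - q \<in> nonpos_poly \<alpha>"
  using keys_diff[of p q] by (auto simp: nonpos_poly_def)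

lemma nonpos_poly_mult:
  assumes "p \<in> nonpos_poly \<alpha>" "q \<in> nonpos_poly \<alpha>"
  shows "p * q \<in> nonpos_poly \<alpha>"
proof -
  have "e \<alpha> \<le> 0" if e: "e \<in> Poly_Mapping.keys (p * q)" for e
  proof -
    obtain a b where "a \<in> Poly_Mapping.keys p" "b \<in> Poly_Mapping.keys q" "e = a + b"
      using e keys_mult[of p q] by blast
    then show ?thesis using assms by (auto simp: nonpos_poly_def intro: add_nonpos_nonpos)
  qed
  then show ?thesis by (simp add: nonpos_poly_def)
qed

lemma nonpos_poly_sum: "(\<And>i. i \<in> A \<Longrightarrow> f i \<in> nonpos_poly \<alpha>) \<Longrightarrow> sum f A \<in> nonpos_poly \<alpha>"
  using keys_sum[of f A] by (fastforce simp: nonpos_poly_def)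

lemma nonpos_series_0: "0 \<in> nonpos_series \<alpha>"
  by (simp add: nonpos_series_def nonpos_poly_0)

lemma nonpos_series_1: "1 \<in> nonpos_series \<alpha>"
  by (simp add: nonpos_series_def nonpos_poly_0 nonpos_poly_1)

lemma nonpos_series_const: "p \<in> nonpos_poly \<alpha> \<Longrightarrow> fps_const p \<in> nonpos_series \<alpha>"
  by (simp add: nonpos_series_def nonpos_poly_0)

lemma nonpos_series_X: "fps_X \<in> nonpos_series \<alpha>"
  by (simp add: nonpos_series_def nonpos_poly_0 nonpos_poly_1 fps_X_def)

lemma nonpos_series_diff:
  "f \<in> nonpos_series \<alpha> \<Longrightarrow> g \<in> nonpos_series \<alpha> \<Longrightarrow> f - g \<in> nonpos_series \<alpha>"
  by (simp add: nonpos_series_def nonpos_poly_diff)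

lemma nonpos_series_mult:
  "f \<in> nonpos_series \<alpha> \<Longrightarrow> g \<in> nonpos_series \<alpha> \<Longrightarrow> f * g \<in> nonpos_series \<alpha>"
  by (simp add: nonpos_series_def fps_mult_nth nonpos_poly_sum nonpos_poly_mult)

lemma nonpos_series_add:
  assumes "f \<in> nonpos_series \<alpha>" "g \<in> nonpos_series \<alpha>"
  shows "f + g \<in> nonpos_series \<alpha>"
proof -
  have "f - f - g \<in> nonpos_series \<alpha>" using assms by (intro nonpos_series_diff)
  then have "f - (f - f - g) \<in> nonpos_series \<alpha>" using assms by (intro nonpos_series_diff)
  then show ?thesis by simp
qed

lemma nonpos_series_power: "f \<in> nonpos_series \<alpha> \<Longrightarrow> f ^ m \<in> nonpos_series \<alpha>"
  by (induction m) (simp_all add: nonpos_series_1 nonpos_series_mult)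

lemma nonpos_series_prod: "(\<And>i. i \<in> A \<Longrightarrow> f i \<in> nonpos_series \<alpha>) \<Longrightarrow> prod f A \<in> nonpos_series \<alpha>"
  by (induction A rule: infinite_finite_induct) (simp_all add: nonpos_series_1 nonpos_series_mult)

lemma nonpos_series_cancel_X:
  assumes "fps_X ^ i * f \<in> nonpos_series \<alpha>"
  shows "f \<in> nonpos_series \<alpha>"
proof -
  have "fps_nth f d \<in> nonpos_poly \<alpha>" for d
  proof -
    have "fps_nth (fps_X ^ i * f) (d + i) \<in> nonpos_poly \<alpha>" using assms by (simp add: nonpos_series_def)
    then show ?thesis by (simp add: fps_X_power_mult_nth)
  qed
  then show ?thesis by (simp add: nonpos_series_def)
qed

lemmas nonpos_series_intros =
  nonpos_series_1 nonpos_series_X nonpos_series_add nonpos_series_diff nonpos_series_mult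
  nonpos_series_power nonpos_series_prod

lemma monom_const_unit: "fps_nth f 0 = monom e \<Longrightarrow> f dvd 1"
  by (intro fps_unitI) (simp add: monom_unit)

text \<open>The inverse of the constant term is again free of \<open>u\<^sub>\<alpha>\<close>, so
  solving \<open>f * g = 1\<close> recursively for the coefficients of \<open>g\<close> never leaves
  the subring.\<close>

lemma nonpos_series_inv:
  assumes f: "f \<in> nonpos_series \<alpha>" and f0: "fps_nth f 0 = monom e" and e: "e \<alpha> = 0"
  shows "unit_inv f \<in> nonpos_series \<alpha>"
proof -
  define g where "g = unit_inv f"
  have fg: "f * g = 1" unfolding g_def using monom_const_unit[OF f0] by (rule unit_inv)
  have "fps_nth g d \<in> nonpos_poly \<alpha>" for d
  proof (induction d rule: less_induct)
    case (less d)
    have "fps_nth (1 :: (('a \<Rightarrow> int) \<Rightarrow>\<^sub>0 int) fps) d = (\<Sum>i=0..d. fps_nth f i * fps_nth g (d - i))"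
      using fps_mult_nth[of f g d] fg by simp
    also have "\<dots> = monom e * fps_nth g d + (\<Sum>i=1..d. fps_nth f i * fps_nth g (d - i))"
      by (simp add: sum.atLeast_Suc_atMost f0)
    finally have *: "monom e * fps_nth g d
        = fps_nth 1 d - (\<Sum>i=1..d. fps_nth f i * fps_nth g (d - i))" by simp
    have "(monom (- e) * monom e) * fps_nth g d
        = monom (- e) * (fps_nth 1 d - (\<Sum>i=1..d. fps_nth f i * fps_nth g (d - i)))"
      unfolding mult.assoc * ..
    also have "monom (- e) * monom e = 1" by (simp add: monom_mult monom_zero)
    finally have "fps_nth g d = monom (- e) * (fps_nth 1 d - (\<Sum>i=1..d. fps_nth f i * fps_nth g (d - i)))"
      by (simp only: mult_1_left)
    moreover have "fps_nth f i * fps_nth g (d - i) \<in> nonpos_poly \<alpha>" if "i \<in> {1..d}" for i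
      using that f less by (intro nonpos_poly_mult) (auto simp: nonpos_series_def)
    then have "fps_nth 1 d - (\<Sum>i=1..d. fps_nth f i * fps_nth g (d - i)) \<in> nonpos_poly \<alpha>"
      by (intro nonpos_poly_diff nonpos_poly_sum) (simp_all add: nonpos_poly_0 nonpos_poly_1)
    moreover have "monom (- e) \<in> nonpos_poly \<alpha>" by (rule nonpos_poly_monom) (simp add: e)
    ultimately show ?case by (simp only: nonpos_poly_mult)
  qed
  then show ?thesis by (simp add: nonpos_series_def g_def)
qed

lemma nonpos_series_ipow:
  assumes "f \<in> nonpos_series \<alpha>" "fps_nth f 0 = monom e" "e \<alpha> = 0"
  shows "ipow f a \<in> nonpos_series \<alpha>"
  using assms by (simp add: ipow_def nonpos_series_power nonpos_series_inv)

text \<open>The formal variable records the total degree of the \<open>m\<^sub>\<alpha>\<^sub>,\<^sub>i\<close>, weighted by \<open>i\<close>, so that only finitely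
  many \<open>m\<close> contribute in each degree.\<close>

fun qsys :: "('r::finite \<Rightarrow> 'r \<Rightarrow> int) \<Rightarrow> nat \<Rightarrow> 'r \<Rightarrow> (('r \<Rightarrow> int) \<Rightarrow>\<^sub>0 int) fps" where
  "qsys C 0 \<alpha> = 1"
| "qsys C (Suc 0) \<alpha> = fps_const (monom (axis \<alpha> (- 1)))"
| "qsys C (Suc (Suc j)) \<alpha> = (qsys C (Suc j) \<alpha> ^ 2
     - fps_X ^ Suc j * (\<Prod>\<beta>\<in>-{\<alpha>}. qsys C (Suc j) \<beta> ^ nat (- C \<beta> \<alpha>))) * unit_inv (qsys C j \<alpha>)"

declare qsys.simps(3) [simp del]

definition qnbr :: "('r::finite \<Rightarrow> 'r \<Rightarrow> int) \<Rightarrow> nat \<Rightarrow> 'r \<Rightarrow> (('r \<Rightarrow> int) \<Rightarrow>\<^sub>0 int) fps" where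
  "qnbr C j \<alpha> = (\<Prod>\<beta>\<in>-{\<alpha>}. qsys C j \<beta> ^ nat (- C \<beta> \<alpha>))"

text \<open>Modulo \<open>fps_X\<close> the recursion says that
  \<open>Q\<^sub>j\<^sub>+\<^sub>2\<close> times \<open>Q\<^sub>j\<close> is the square of
  \<open>Q\<^sub>j\<^sub>+\<^sub>1\<close>, which the powers of
  \<open>u\<^sub>\<alpha>\<^sup>-\<^sup>1\<close> solve. In particular every \<open>qsys\<close> is
  a unit.\<close>

lemma qsys_nth_0: "fps_nth (qsys C j \<alpha>) 0 = monom (axis \<alpha> (- int j))"
proof (induction C j \<alpha> rule: qsys.induct)
  case (3 C j \<alpha>)
  have "fps_nth (qsys C j \<alpha> * unit_inv (qsys C j \<alpha>)) 0 = 1"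
    using unit_inv[OF monom_const_unit[OF 3(3)]] by simp
  then have "monom (axis \<alpha> (- int j)) * fps_nth (unit_inv (qsys C j \<alpha>)) 0 = 1"
    using 3(3) by simp
  then have "monom (axis \<alpha> (int j)) * monom (axis \<alpha> (- int j)) * fps_nth (unit_inv (qsys C j \<alpha>)) 0
      = monom (axis \<alpha> (int j))"
    by (simp add: mult.assoc)
  then have "fps_nth (unit_inv (qsys C j \<alpha>)) 0 = monom (axis \<alpha> (int j))"
    by (simp add: monom_mult axis_add axis_zero monom_zero)
  then show ?case
    by (simp add: 3(1) qsys.simps(3) fps_power_zeroth monom_axis_power monom_mult axis_add algebra_simps)
qed (simp_all add: axis_zero monom_zero)

lemma qsys_unit: "qsys C j \<alpha> dvd 1"
  by (rule monom_const_unit[OF qsys_nth_0])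

lemma qsys_rec:
  "qsys C (Suc (Suc j)) \<alpha> * qsys C j \<alpha> = qsys C (Suc j) \<alpha> ^ 2 - fps_X ^ Suc j * qnbr C (Suc j) \<alpha>"
proof -
  have "qsys C (Suc (Suc j)) \<alpha> * qsys C j \<alpha> = (qsys C (Suc j) \<alpha> ^ 2
      - fps_X ^ Suc j * qnbr C (Suc j) \<alpha>) * (qsys C j \<alpha> * unit_inv (qsys C j \<alpha>))"
    by (simp only: qsys.simps qnbr_def mult_ac)
  then show ?thesis by (simp only: unit_inv[OF qsys_unit] mult_1_right)
qed

text \<open>The product omits the vertex \<alpha>. This makes \<open>qnbr C j \<alpha>\<close>
  invertible inside \<open>nonpos_series \<alpha>\<close> as soon as it lies there.\<close>

lemma qnbr_nth_0: "\<exists>e. fps_nth (qnbr C j \<alpha>) 0 = monom e \<and> e \<alpha> = 0"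
proof -
  have "\<exists>e. fps_nth (\<Prod>\<beta>\<in>A. qsys C j \<beta> ^ nat (- C \<beta> \<alpha>)) 0 = monom e \<and> e \<alpha> = 0"
    if "finite A" "\<alpha> \<notin> A" for A
    using that
  proof induction
    case empty
    then show ?case by (auto intro: exI[of _ 0] simp: monom_zero)
  next
    case (insert \<beta> A)
    then obtain e where e: "fps_nth (\<Prod>\<beta>\<in>A. qsys C j \<beta> ^ nat (- C \<beta> \<alpha>)) 0 = monom e" "e \<alpha> = 0" by auto
    show ?case
    proof (intro exI conjI)
      show "fps_nth (\<Prod>\<beta>\<in>insert \<beta> A. qsys C j \<beta> ^ nat (- C \<beta> \<alpha>)) 0
          = monom (axis \<beta> (- int j * int (nat (- C \<beta> \<alpha>))) + e)"
        by (simp only: prod.insert[OF insert(1,2)] fps_mult_nth_0 fps_power_zeroth qsys_nth_0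
            monom_axis_power e(1) monom_mult)
    qed (use insert e in \<open>auto simp: axis_def\<close>)
  qed
  then show ?thesis unfolding qnbr_def by simp
qed

section \<open>The Laurent phenomenon for the Q-system\<close>

lemma qsys_nonpos_step_other:
  assumes "\<beta> \<noteq> \<alpha>" "\<And>\<gamma>. qsys C j \<gamma> \<in> nonpos_series \<alpha>" "\<And>\<gamma>. qsys C (Suc j) \<gamma> \<in> nonpos_series \<alpha>"
  shows "qsys C (Suc (Suc j)) \<beta> \<in> nonpos_series \<alpha>"
proof -
  \<comment> \<open>The constant term of the denominator is a power of
    \<open>u\<^sub>\<beta>\<close>, hence free of \<open>u\<^sub>\<alpha>\<close>.\<close>
  have "unit_inv (qsys C j \<beta>) \<in> nonpos_series \<alpha>"
    using assms by (intro nonpos_series_inv[OF _ qsys_nth_0]) (auto simp: axis_def)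
  then show ?thesis unfolding qsys.simps using assms by (intro nonpos_series_intros)
qed

lemma qnbr_nonpos: "(\<And>\<beta>. qsys C j \<beta> \<in> nonpos_series \<alpha>) \<Longrightarrow> qnbr C j \<gamma> \<in> nonpos_series \<alpha>"
  unfolding qnbr_def by (intro nonpos_series_intros) auto

text \<open>Congruence modulo \<open>a\<close> with a cofactor in the subring. In the application
  \<open>a\<close> is a unit of the full series ring, where divisibility by \<open>a\<close> would
  say nothing.\<close>

lemma power_diff_multiple:
  assumes "x = y - a * w" "x \<in> nonpos_series \<alpha>" "y \<in> nonpos_series \<alpha>" "a \<in> nonpos_series \<alpha>" "w \<in> nonpos_series \<alpha>"
  shows "\<exists>v\<in>nonpos_series \<alpha>. x ^ m = y ^ m - a * v"
proof (induction m)
  case 0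
  then show ?case by (intro bexI[of _ 0]) (simp_all add: nonpos_series_0)
next
  case (Suc m)
  then obtain v where v: "v \<in> nonpos_series \<alpha>" "x ^ m = y ^ m - a * v" by auto
  have "x ^ Suc m = y * x ^ m - a * w * x ^ m" by (simp add: assms(1) algebra_simps)
  also have "\<dots> = y ^ Suc m - a * (y * v + w * x ^ m)" by (subst (1) v(2)) (simp add: algebra_simps)
  finally show ?case using v assms by (auto intro!: nonpos_series_intros bexI[of _ "y * v + w * x ^ m"])
qed

lemma prod_diff_multiple:
  assumes "finite A" "a \<in> nonpos_series \<alpha>"
    "\<And>i. i \<in> A \<Longrightarrow> x i \<in> nonpos_series \<alpha>" "\<And>i. i \<in> A \<Longrightarrow> y i \<in> nonpos_series \<alpha>"
    "\<And>i. i \<in> A \<Longrightarrow> \<exists>w\<in>nonpos_series \<alpha>. x i = y i - a * w"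
  shows "\<exists>v\<in>nonpos_series \<alpha>. prod x A = prod y A - a * v"
  using assms
proof (induction A rule: finite_induct)
  case empty
  then show ?case by (intro bexI[of _ 0]) (simp_all add: nonpos_series_0)
next
  case (insert i A)
  then obtain v w where v: "v \<in> nonpos_series \<alpha>" "prod x A = prod y A - a * v"
    and w: "w \<in> nonpos_series \<alpha>" "x i = y i - a * w"
    by (metis insertCI)
  have "prod x (insert i A) = y i * prod x A - a * (w * prod x A)"
    using insert(1,2) by (simp add: w(2) algebra_simps)
  also have "\<dots> = prod y (insert i A) - a * (y i * v + w * prod x A)"
    using insert by (subst (1) v(2)) (simp add: algebra_simps)
  finally show ?case using v w insert
    by (auto intro!: nonpos_series_intros bexI[of _ "y i * v + w * prod x A"])
qed

text \<open>What the Q-system argument uses of the Cartan matrix. Injectivity enters separately,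
  through \<open>degree_determined\<close>.\<close>

locale cartan_like =
  fixes C :: "'r::finite \<Rightarrow> 'r \<Rightarrow> int"
  assumes diag: "C \<alpha> \<alpha> = 2"
    and off_diag: "\<alpha> \<noteq> \<beta> \<Longrightarrow> C \<alpha> \<beta> \<le> 0"
    and zero_pattern: "C \<alpha> \<beta> = 0 \<Longrightarrow> C \<beta> \<alpha> = 0"
begin

abbreviation "Q \<equiv> qsys C"
abbreviation "V \<equiv> qnbr C"

text \<open>If \<open>C \<beta> \<alpha>\<close> is nonzero, so is
  \<open>C \<alpha> \<beta>\<close>; then \<open>Q (Suc j) \<alpha>\<close> divides the neighbour
  product at \<beta>, and the recursion at \<beta> becomes \<open>Q (Suc (Suc j)) \<beta> * Q j
  \<beta> = Q (Suc j) \<beta> ^ 2\<close> modulo it. These congruences are multiplied over all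
  \<beta>.\<close>

lemma qnbr_rec:
  assumes R: "\<And>i \<beta>. i \<le> Suc (Suc j) \<Longrightarrow> \<beta> \<noteq> \<alpha> \<or> i < Suc (Suc j) \<Longrightarrow> Q i \<beta> \<in> nonpos_series \<alpha>"
  shows "\<exists>w\<in>nonpos_series \<alpha>. V (Suc (Suc j)) \<alpha> * V j \<alpha> = V (Suc j) \<alpha> ^ 2 - Q (Suc j) \<alpha> * w"
proof -
  define p where "p \<beta> = nat (- C \<beta> \<alpha>)" for \<beta>
  have "\<exists>w\<in>nonpos_series \<alpha>. (Q (Suc (Suc j)) \<beta> * Q j \<beta>) ^ p \<beta> = (Q (Suc j) \<beta> ^ 2) ^ p \<beta> - Q (Suc j) \<alpha> * w"
    if \<beta>: "\<beta> \<noteq> \<alpha>" for \<beta>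
  proof (cases "C \<beta> \<alpha> = 0")
    case True
    then show ?thesis by (intro bexI[of _ 0]) (simp_all add: p_def nonpos_series_0)
  next
    case False
    then have "C \<alpha> \<beta> < 0" using zero_pattern[of \<alpha> \<beta>] off_diag[of \<alpha> \<beta>] \<beta> by fastforce
    then obtain m where m: "nat (- C \<alpha> \<beta>) = Suc m" by (metis neg_0_less_iff_less not0_implies_Suc zero_less_nat_eq less_irrefl)
    define w where "w = fps_X ^ Suc j * (Q (Suc j) \<alpha> ^ m * (\<Prod>\<gamma>\<in>-{\<beta>}-{\<alpha>}. Q (Suc j) \<gamma> ^ nat (- C \<gamma> \<beta>)))"
    have "V (Suc j) \<beta> = Q (Suc j) \<alpha> ^ Suc m * (\<Prod>\<gamma>\<in>-{\<beta>}-{\<alpha>}. Q (Suc j) \<gamma> ^ nat (- C \<gamma> \<beta>))"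
      unfolding qnbr_def using \<beta> m by (subst prod.remove[of _ \<alpha>]) auto
    then have "Q (Suc (Suc j)) \<beta> * Q j \<beta> = Q (Suc j) \<beta> ^ 2 - Q (Suc j) \<alpha> * w"
      unfolding qsys_rec w_def by (simp add: algebra_simps)
    moreover have "w \<in> nonpos_series \<alpha>"
      unfolding w_def by (intro nonpos_series_intros R) auto
    ultimately show ?thesis
      using \<beta> by (intro power_diff_multiple) (auto intro!: nonpos_series_intros R simp del: qsys.simps)
  qed
  then have "\<exists>w\<in>nonpos_series \<alpha>. (\<Prod>\<beta>\<in>-{\<alpha>}. (Q (Suc (Suc j)) \<beta> * Q j \<beta>) ^ p \<beta>)
      = (\<Prod>\<beta>\<in>-{\<alpha>}. (Q (Suc j) \<beta> ^ 2) ^ p \<beta>) - Q (Suc j) \<alpha> * w"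
    by (intro prod_diff_multiple) (auto intro!: nonpos_series_intros R simp del: qsys.simps)
  moreover have "V i \<alpha> = (\<Prod>\<beta>\<in>-{\<alpha>}. Q i \<beta> ^ p \<beta>)" for i
    by (simp add: qnbr_def p_def)
  ultimately show ?thesis
    by (simp add: power_mult_distrib prod.distrib prod_power_distrib power_mult[symmetric] mult.commute del: qsys.simps)
qed

text \<open>The Laurent phenomenon at the vertex \<open>\<alpha>\<close>: although \<open>Q (j + 1) \<alpha>\<close> is not invertible among the
  series without positive powers of \<open>u\<^sub>\<alpha>\<close>, it divides the right-hand side of the recursion there, since
  modulo it \<open>X\<^sup>j V j \<alpha> = (Q j \<alpha>)\<^sup>2\<close> and \<open>V (j + 2) \<alpha> * V j \<alpha> = (V (j + 1) \<alpha>)\<^sup>2\<close>.\<close>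

lemma qsys_nonpos_step:
  assumes R: "\<And>i \<beta>. i \<le> Suc (Suc j) \<Longrightarrow> Q i \<beta> \<in> nonpos_series \<alpha>"
  shows "Q (Suc (Suc (Suc j))) \<alpha> \<in> nonpos_series \<alpha>"
proof -
  let ?a = "Q (Suc j) \<alpha>"
  \<comment> \<open>For \<open>j = 0\<close> both \<open>V\<close> and \<open>Q\<close> are 1 and
    \<open>z = 0\<close>; otherwise this is the recursion one step earlier, with
    \<open>z = Q (j - 1) \<alpha>\<close>.\<close>
  obtain z where z: "z \<in> nonpos_series \<alpha>" "fps_X ^ j * V j \<alpha> = Q j \<alpha> ^ 2 - ?a * z"
  proof (cases j)
    case 0
    then show ?thesis
      using that[of 0] by (simp add: qnbr_def nonpos_series_0)
  next
    case (Suc i)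
    then show ?thesis
      using that[of "Q i \<alpha>"] R[of i] qsys_rec[of C i \<alpha>] by (simp add: algebra_simps del: qsys.simps)
  qed
  obtain w where w: "w \<in> nonpos_series \<alpha>" "V (Suc (Suc j)) \<alpha> * V j \<alpha> = V (Suc j) \<alpha> ^ 2 - ?a * w"
    using qnbr_rec R by blast
  define x where "x = Q (Suc (Suc j)) \<alpha>"
  define s where "s = fps_X ^ Suc j * V (Suc j) \<alpha>"
  \<comment> \<open>The quotient by \<open>?a\<close> of \<open>fps_X ^ j * V j \<alpha>\<close>
    times the right-hand side of the recursion: the two \<open>s ^ 2\<close> cancel, and all
    remaining terms contain \<open>?a\<close>.\<close>
  define y where "y = ?a ^ 3 - 2 * ?a * s - z * x ^ 2 + fps_X ^ (2 * j + 2) * w"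
  have x: "x * Q j \<alpha> = ?a ^ 2 - s" unfolding x_def s_def by (rule qsys_rec)
  have rec: "Q (Suc (Suc (Suc j))) \<alpha> * ?a = x ^ 2 - fps_X ^ (j + 2) * V (Suc (Suc j)) \<alpha>"
    unfolding x_def by (subst qsys_rec) simp
  have "fps_X ^ j * V j \<alpha> * (Q (Suc (Suc (Suc j))) \<alpha> * ?a)
      = (fps_X ^ j * V j \<alpha>) * x ^ 2 - fps_X ^ (2 * j + 2) * (V (Suc (Suc j)) \<alpha> * V j \<alpha>)"
    unfolding rec by (simp add: algebra_simps power_add mult_2_right)
  also have "\<dots> = (x * Q j \<alpha>) ^ 2 - ?a * z * x ^ 2 - s ^ 2 + ?a * (fps_X ^ (2 * j + 2) * w)"
    unfolding z(2) w(2) by (simp add: s_def algebra_simps power2_eq_square power_add mult_2_right)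
  also have "\<dots> = y * ?a"
    unfolding x by (simp add: y_def algebra_simps power2_eq_square power3_eq_cube)
  finally have "(fps_X ^ j * V j \<alpha> * Q (Suc (Suc (Suc j))) \<alpha>) * ?a = y * ?a" by (simp only: mult_ac)
  \<comment> \<open>The factor \<open>?a\<close> is cancelled in the full ring, but the formula for
    \<open>y\<close> contains no inverse and so stays in the subring.\<close>
  then have "fps_X ^ j * V j \<alpha> * Q (Suc (Suc (Suc j))) \<alpha> = y"
    by (rule unit_cancel_right[OF qsys_unit])
  moreover have "y \<in> nonpos_series \<alpha>"
  proof -
    have "V (Suc j) \<alpha> \<in> nonpos_series \<alpha>" using R by (intro qnbr_nonpos) auto
    then show ?thesis unfolding y_def s_def x_def mult_2
      by (intro nonpos_series_intros R z w) (auto simp del: one_add_one simp flip: one_add_one intro!: nonpos_series_intros)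
  qed
  moreover obtain e where e: "fps_nth (V j \<alpha>) 0 = monom e" "e \<alpha> = 0" using qnbr_nth_0 by blast
  \<comment> \<open>It remains to remove \<open>V j \<alpha>\<close>, a unit of the subring, and
    \<open>fps_X ^ j\<close>, which only shifts coefficients.\<close>
  moreover have "unit_inv (V j \<alpha>) \<in> nonpos_series \<alpha>"
    using R by (intro nonpos_series_inv[OF qnbr_nonpos e]) auto
  ultimately have "unit_inv (V j \<alpha>) * (fps_X ^ j * V j \<alpha> * Q (Suc (Suc (Suc j))) \<alpha>) \<in> nonpos_series \<alpha>"
    by (simp add: nonpos_series_mult)
  also have "unit_inv (V j \<alpha>) * (fps_X ^ j * V j \<alpha> * Q (Suc (Suc (Suc j))) \<alpha>)
      = fps_X ^ j * (V j \<alpha> * unit_inv (V j \<alpha>)) * Q (Suc (Suc (Suc j))) \<alpha>"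
    by (simp only: mult_ac)
  finally show ?thesis
    unfolding unit_inv[OF monom_const_unit[OF e(1)]] mult_1_right by (rule nonpos_series_cancel_X)
qed

lemma qsys_nonpos: "Q j \<beta> \<in> nonpos_series \<alpha>"
proof (induction j arbitrary: \<beta> rule: less_induct)
  case (less j)
  consider "j = 0" | "j = 1" | i where "j = Suc (Suc i)" by (metis One_nat_def not0_implies_Suc)
  then show ?case
  proof cases
    case 3
    show ?thesis
    proof (cases "\<beta> = \<alpha>")
      case False
      then show ?thesis unfolding 3 using 3 less by (intro qsys_nonpos_step_other) auto
    next
      case True
      show ?thesis
      proof (cases i)
        case 0
        \<comment> \<open>The general step starts at index 3. At index 2 the denominator is
          \<open>Q 0 \<alpha> = 1\<close>.\<close>
        have "unit_inv 1 = (1 :: (('r \<Rightarrow> int) \<Rightarrow>\<^sub>0 int) fps)" using unit_inv[of "1 :: (('r \<Rightarrow> int) \<Rightarrow>\<^sub>0 int) fps"] by simp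
        moreover have "Q (Suc 0) \<gamma> \<in> nonpos_series \<alpha>" for \<gamma> using less[of "Suc 0"] 3 0 by (simp del: qsys.simps)
        ultimately show ?thesis
          unfolding 3 0 qsys.simps(3) qsys.simps(1) by (simp add: nonpos_series_intros del: qsys.simps)
      next
        case (Suc i')
        then show ?thesis unfolding 3 Suc True using 3 Suc less by (intro qsys_nonpos_step) auto
      qed
    qed
  qed (auto intro!: nonpos_series_1 nonpos_series_const nonpos_poly_monom simp: axis_def)
qed

end

section \<open>Summation over the lower levels\<close>

lemma is_unit_mult: "x dvd 1 \<Longrightarrow> y dvd 1 \<Longrightarrow> x * y dvd 1"
  for x :: "'a::comm_monoid_mult"
  using mult_dvd_mono[of x 1 y 1] by simp

lemma prod_cong_mod:
  fixes f g :: "'i \<Rightarrow> 'a::comm_ring_1"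
  assumes "\<And>i. i \<in> A \<Longrightarrow> c dvd f i - g i"
  shows "c dvd prod f A - prod g A"
  using assms
proof (induction A rule: infinite_finite_induct)
  case (insert i A)
  have "prod f (insert i A) - prod g (insert i A)
      = (f i - g i) * prod f A + g i * (prod f A - prod g A)"
    using insert(1,2) by (simp add: algebra_simps)
  also have "c dvd \<dots>" using insert by (intro dvd_add dvd_mult dvd_mult2) auto
  finally show ?case .
qed simp_all

lemma lookup_of_int_mult: "Poly_Mapping.lookup (of_int c * p) e = c * Poly_Mapping.lookup p e"
  for p :: "('a::comm_monoid_add) \<Rightarrow>\<^sub>0 int"
  by (induction c rule: int_induct[where k = 0])
    (simp_all add: distrib_right left_diff_distrib lookup_add lookup_minus)

lemma fps_of_int_mult_nth: "fps_nth (of_int c * f) d = of_int c * fps_nth f d"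
  by (simp flip: fps_of_int)

lemma unit_inv_1 [simp]: "unit_inv 1 = 1"
  using unit_inv[of "1::'a"] by simp

lemma ipow_one [simp]: "ipow 1 c = 1"
  by (simp add: ipow_def)

lemma ipow_qsys_1: "ipow (qsys C (Suc 0) \<alpha>) c = fps_const (monom (axis \<alpha> (- c)))"
proof (induction c rule: int_induct[where k = 0])
  case (step1 i)
  then show ?case by (simp add: ipow_plus_1 monom_const_unit monom_mult axis_add)
next
  case (step2 i)
  have "ipow (qsys C (Suc 0) \<alpha>) (i - 1) * qsys C (Suc 0) \<alpha>
      = fps_const (monom (axis \<alpha> (- (i - 1)))) * qsys C (Suc 0) \<alpha>"
    unfolding ipow_minus_1[OF qsys_unit] step2 by (simp add: monom_mult axis_add)
  then show ?case by (rule unit_cancel_right[OF qsys_unit])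
qed (simp add: axis_zero monom_zero)

lemma prod_monom: "(\<Prod>i\<in>A. fps_const (monom (f i))) = fps_const (monom (\<Sum>i\<in>A. f i))"
  by (induction A rule: infinite_finite_induct) (simp_all add: monom_zero monom_mult plus_fun_def)

text \<open>The generating function of the sums over the \<open>m\<^sub>\<alpha>\<^sub>,\<^sub>i\<close> with \<open>i \<le> j\<close>, for fixed values \<open>a\<close> of
  \<open>q\<^sub>j\<^sub>+\<^sub>1\<close> and \<open>b\<close> of \<open>q\<^sub>j\<close>.\<close>

definition gen_fun :: "('r::finite \<Rightarrow> 'r \<Rightarrow> int) \<Rightarrow> ('r \<Rightarrow> nat \<Rightarrow> nat) \<Rightarrow> nat \<Rightarrow> ('r \<Rightarrow> int) \<Rightarrow> ('r \<Rightarrow> int)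
    \<Rightarrow> (('r \<Rightarrow> int) \<Rightarrow>\<^sub>0 int) fps" where
  "gen_fun C n j a b = (\<Prod>\<alpha>\<in>UNIV. qsys C (Suc 0) \<alpha> * ipow (qsys C (Suc j) \<alpha>) (- b \<alpha> - 1)
     * ipow (qsys C j \<alpha>) (a \<alpha> + 1) * (\<Prod>i=1..j. qsys C i \<alpha> ^ n \<alpha> i))"

text \<open>With no level left to sum, \<open>b\<close> is the exponent of the
  \<open>u\<^sub>\<alpha>\<close> itself; the factor \<open>qsys C (Suc 0) \<alpha>\<close> absorbs
  the \<open>- 1\<close> in \<open>- b \<alpha> - 1\<close>.\<close>

lemma gen_fun_0: "gen_fun C n 0 a b = fps_const (monom b)"
proof -
  have "qsys C (Suc 0) \<alpha> * ipow (qsys C (Suc 0) \<alpha>) (- b \<alpha> - 1) = fps_const (monom (axis \<alpha> (b \<alpha>)))" for \<alpha>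
    using ipow_minus_1[OF qsys_unit, of C "Suc 0" \<alpha> "- b \<alpha>"] ipow_qsys_1[of C \<alpha> "- b \<alpha>"]
    by (simp add: mult.commute del: qsys.simps(2))
  then show ?thesis
    by (simp add: gen_fun_def prod_monom sum_axis del: qsys.simps(2))
qed

lemma sum_prod_fun:
  fixes f :: "'r::finite \<Rightarrow> nat \<Rightarrow> 'a::comm_semiring_1"
  shows "(\<Prod>\<alpha>\<in>UNIV. \<Sum>i\<le>N. f \<alpha> i) = (\<Sum>\<mu> | \<forall>\<alpha>. \<mu> \<alpha> \<le> N. \<Prod>\<alpha>\<in>UNIV. f \<alpha> (\<mu> \<alpha>))"
proof -
  have "{\<mu>. \<forall>\<alpha>. \<mu> \<alpha> \<le> N} = (\<Pi>\<^sub>E \<alpha>\<in>(UNIV :: 'r set). {..N})" by (auto simp: PiE_UNIV_domain)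
  then show ?thesis by (simp add: prod_sum_PiE)
qed

context cartan_like begin

text \<open>The diagonal entry 2 contributes the inverse square of \<open>Q j \<beta>\<close>, so
  the full product over a column of \<open>C\<close> is the ratio occurring in the recursion divided
  by that square.\<close>

lemma prod_ipow_cartan:
  "(\<Prod>\<alpha>\<in>UNIV. ipow (Q j \<alpha>) (- C \<alpha> \<beta>)) * Q j \<beta> ^ 2 = V j \<beta>"
proof -
  have "(\<Prod>\<alpha>\<in>-{\<beta>}. ipow (Q j \<alpha>) (- C \<alpha> \<beta>)) = V j \<beta>"
    unfolding qnbr_def
  proof (rule prod.cong[OF refl])
    fix \<alpha> assume "\<alpha> \<in> -{\<beta>}"
    then show "ipow (Q j \<alpha>) (- C \<alpha> \<beta>) = Q j \<alpha> ^ nat (- C \<alpha> \<beta>)"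
      using off_diag[of \<alpha> \<beta>] by (simp add: ipow_def)
  qed
  moreover have "ipow (Q j \<beta>) (- 2) * Q j \<beta> ^ 2 = 1"
    using ipow_uminus_cancel[OF qsys_unit, of C j \<beta> 2] ipow_of_nat[of "Q j \<beta>" 2] by (simp add: mult.commute)
  ultimately show ?thesis
    by (subst prod.remove[of _ \<beta>]) (auto simp: diag Compl_eq_Diff_UNIV mult_ac)
qed

text \<open>Summation over level \<open>Suc j\<close>. Here \<open>b'\<close> is the value of
  \<open>q\<^sub>j\<close> forced by \<open>q_part_rec\<close>; it is affine in \<mu>, so \<mu>
  enters \<open>gen_fun\<close> only through powers of the \<open>W \<beta>\<close>, and the sum
  factors into one binomial series in \<open>T \<beta>\<close> for each vertex.\<close>

lemma gen_fun_Suc: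
  fixes n :: "'r \<Rightarrow> nat \<Rightarrow> nat" and a b :: "'r \<Rightarrow> int" and j :: nat
  defines "b' \<equiv> \<lambda>\<mu> \<alpha>. 2 * b \<alpha> - a \<alpha> + (\<Sum>\<beta>\<in>UNIV. C \<alpha> \<beta> * int (\<mu> \<beta>)) - int (n \<alpha> (Suc j))"
  shows "fps_X ^ Suc N dvd (\<Sum>\<mu> | \<forall>\<alpha>. \<mu> \<alpha> \<le> N. of_int (\<Prod>\<alpha>\<in>UNIV. binom (\<mu> \<alpha>) (b \<alpha>))
     * (fps_X ^ (Suc j * (\<Sum>\<alpha>\<in>UNIV. \<mu> \<alpha>)) * gen_fun C n j b (b' \<mu>))) - gen_fun C n (Suc j) a b"
proof -
  define W where "W \<beta> = (\<Prod>\<alpha>\<in>UNIV. ipow (Q (Suc j) \<alpha>) (- C \<alpha> \<beta>))" for \<beta>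
  define T where "T \<beta> = fps_X ^ Suc j * W \<beta>" for \<beta>
  \<comment> \<open>The term at \<mu> = 0, without its binomial coefficients.\<close>
  define F0 where "F0 = gen_fun C n j b (\<lambda>\<alpha>. 2 * b \<alpha> - a \<alpha> - int (n \<alpha> (Suc j)))"
  note unit = qsys_unit[of C]
  have gen_fun_b': "gen_fun C n j b (b' \<mu>) = F0 * (\<Prod>\<beta>\<in>UNIV. W \<beta> ^ \<mu> \<beta>)" for \<mu>
  proof -
    have "(\<Prod>\<beta>\<in>UNIV. W \<beta> ^ \<mu> \<beta>) = (\<Prod>\<beta>\<in>UNIV. \<Prod>\<alpha>\<in>UNIV. ipow (Q (Suc j) \<alpha>) (- C \<alpha> \<beta> * int (\<mu> \<beta>)))"
      unfolding W_def prod_power_distrib by (simp only: ipow_mult_nat unit)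
    also have "\<dots> = (\<Prod>\<alpha>\<in>UNIV. ipow (Q (Suc j) \<alpha>) (\<Sum>\<beta>\<in>UNIV. - C \<alpha> \<beta> * int (\<mu> \<beta>)))"
      unfolding ipow_sum[OF unit] by (rule prod.swap)
    finally have W: "(\<Prod>\<beta>\<in>UNIV. W \<beta> ^ \<mu> \<beta>) = \<dots>" .
    have "- b' \<mu> \<alpha> - 1 = (- (2 * b \<alpha> - a \<alpha> - int (n \<alpha> (Suc j))) - 1) + (\<Sum>\<beta>\<in>UNIV. - C \<alpha> \<beta> * int (\<mu> \<beta>))"
      for \<alpha> by (simp add: b'_def sum_negf)
    then show ?thesis
      unfolding F0_def gen_fun_def W prod.distrib[symmetric]
      by (intro prod.cong refl) (simp only: ipow_add unit mult_ac)
  qed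
  have TQ: "1 - T \<beta> = Q (Suc (Suc j)) \<beta> * Q j \<beta> * ipow (Q (Suc j) \<beta>) (- 2)" for \<beta>
  proof -
    have one: "Q (Suc j) \<beta> ^ 2 * ipow (Q (Suc j) \<beta>) (- 2) = 1"
      using ipow_uminus_cancel[OF unit, of "Suc j" \<beta> 2] ipow_of_nat[of "Q (Suc j) \<beta>" 2] by simp
    have rec: "Q (Suc (Suc j)) \<beta> * Q j \<beta> = Q (Suc j) \<beta> ^ 2 - fps_X ^ Suc j * (W \<beta> * Q (Suc j) \<beta> ^ 2)"
      unfolding qsys_rec W_def prod_ipow_cartan ..
    have "Q (Suc (Suc j)) \<beta> * Q j \<beta> * ipow (Q (Suc j) \<beta>) (- 2)
        = (1 - T \<beta>) * (Q (Suc j) \<beta> ^ 2 * ipow (Q (Suc j) \<beta>) (- 2))"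
      unfolding rec by (simp add: T_def algebra_simps)
    then show ?thesis unfolding one by simp
  qed
  have closed: "F0 * (\<Prod>\<beta>\<in>UNIV. ipow (1 - T \<beta>) (- b \<beta> - 1)) = gen_fun C n (Suc j) a b"
  proof -
    \<comment> \<open>The powers \<open>b \<beta> + 1\<close> and \<open>- (b \<beta> + 1)\<close>
      of \<open>Q j \<beta>\<close> cancel, and the exponents of \<open>Q (Suc j) \<beta>\<close>
      add up to \<open>a \<beta> + 1 + n \<beta> (Suc j)\<close>.\<close>
    have "Q (Suc 0) \<beta> * ipow (Q (Suc j) \<beta>) (- (2 * b \<beta> - a \<beta> - int (n \<beta> (Suc j))) - 1)
         * ipow (Q j \<beta>) (b \<beta> + 1) * (\<Prod>i=1..j. Q i \<beta> ^ n \<beta> i) * ipow (1 - T \<beta>) (- b \<beta> - 1)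
       = Q (Suc 0) \<beta> * ipow (Q (Suc (Suc j)) \<beta>) (- b \<beta> - 1) * ipow (Q (Suc j) \<beta>) (a \<beta> + 1)
         * (\<Prod>i=1..Suc j. Q i \<beta> ^ n \<beta> i)" (is "?l = ?r") for \<beta>
    proof -
      have T: "ipow (1 - T \<beta>) (- b \<beta> - 1) = ipow (Q (Suc (Suc j)) \<beta>) (- b \<beta> - 1)
          * ipow (Q j \<beta>) (- (b \<beta> + 1)) * ipow (Q (Suc j) \<beta>) (- 2 * (- b \<beta> - 1))"
        unfolding TQ by (simp only: ipow_mult_base is_unit_mult ipow_ipow ipow_unit unit minus_add_distrib
            diff_conv_add_uminus)
      have "ipow (Q (Suc j) \<beta>) (- (2 * b \<beta> - a \<beta> - int (n \<beta> (Suc j))) - 1)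
          * ipow (Q (Suc j) \<beta>) (- 2 * (- b \<beta> - 1))
        = ipow (Q (Suc j) \<beta>) ((a \<beta> + 1) + int (n \<beta> (Suc j)))"
        unfolding ipow_add[OF unit, symmetric] by (rule arg_cong) simp
      then have e: "ipow (Q (Suc j) \<beta>) (- (2 * b \<beta> - a \<beta> - int (n \<beta> (Suc j))) - 1)
          * ipow (Q (Suc j) \<beta>) (- 2 * (- b \<beta> - 1))
        = ipow (Q (Suc j) \<beta>) (a \<beta> + 1) * Q (Suc j) \<beta> ^ n \<beta> (Suc j)"
        unfolding ipow_add[OF unit] ipow_of_nat .
      have "?l = Q (Suc 0) \<beta> * ipow (Q (Suc (Suc j)) \<beta>) (- b \<beta> - 1)
          * (ipow (Q (Suc j) \<beta>) (- (2 * b \<beta> - a \<beta> - int (n \<beta> (Suc j))) - 1)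
              * ipow (Q (Suc j) \<beta>) (- 2 * (- b \<beta> - 1)))
          * (ipow (Q j \<beta>) (b \<beta> + 1) * ipow (Q j \<beta>) (- (b \<beta> + 1))) * (\<Prod>i=1..j. Q i \<beta> ^ n \<beta> i)"
        unfolding T by (simp only: mult_ac)
      also have "\<dots> = ?r"
        unfolding e ipow_uminus_cancel[OF unit] by (simp add: mult_ac)
      finally show ?thesis .
    qed
    then show ?thesis
      unfolding F0_def gen_fun_def prod.distrib[symmetric] by (intro prod.cong refl)
  qed
  have "(\<Sum>\<mu> | \<forall>\<alpha>. \<mu> \<alpha> \<le> N. of_int (\<Prod>\<alpha>\<in>UNIV. binom (\<mu> \<alpha>) (b \<alpha>))
      * (fps_X ^ (Suc j * (\<Sum>\<alpha>\<in>UNIV. \<mu> \<alpha>)) * gen_fun C n j b (b' \<mu>)))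
    = F0 * (\<Sum>\<mu> | \<forall>\<alpha>. \<mu> \<alpha> \<le> N. \<Prod>\<alpha>\<in>UNIV. of_int (binom (\<mu> \<alpha>) (b \<alpha>)) * T \<alpha> ^ \<mu> \<alpha>)"
    unfolding gen_fun_b' T_def sum_distrib_left
    by (intro sum.cong refl) (simp only: prod.distrib power_mult_distrib power_mult[symmetric]
        sum_distrib_left power_sum of_int_prod mult_ac)
  also have "\<dots> = F0 * (\<Prod>\<alpha>\<in>UNIV. \<Sum>i\<le>N. of_int (binom i (b \<alpha>)) * T \<alpha> ^ i)"
    unfolding sum_prod_fun ..
  also have "\<dots> - gen_fun C n (Suc j) a b = F0 * ((\<Prod>\<alpha>\<in>UNIV. \<Sum>i\<le>N. of_int (binom i (b \<alpha>)) * T \<alpha> ^ i)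
      - (\<Prod>\<alpha>\<in>UNIV. ipow (1 - T \<alpha>) (- b \<alpha> - 1)))"
    unfolding closed[symmetric] right_diff_distrib ..
  also have "fps_X ^ Suc N dvd \<dots>"
    by (intro dvd_mult prod_cong_mod binom_series) (simp add: T_def)
  finally show ?thesis .
qed

text \<open>At \<alpha> the exponents \<open>- b \<alpha> - 1\<close> and
  \<open>a \<alpha> + 1\<close> are nonnegative; at the other vertices any exponent is harmless, the
  \<open>Q i \<beta>\<close> being units of the subring. The factor
  \<open>Q (Suc 0) \<alpha>\<close> then shifts all exponents of \<open>u\<^sub>\<alpha>\<close>
  below zero.\<close>

lemma gen_fun_vanishes:
  assumes "\<And>\<beta>. 0 \<le> a \<beta>" "b \<alpha> < 0" "0 \<le> e \<alpha>"
  shows "Poly_Mapping.lookup (fps_nth (gen_fun C n j a b) d) e = 0"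
proof -
  let ?f = "\<lambda>\<beta>. ipow (Q (Suc j) \<beta>) (- b \<beta> - 1) * ipow (Q j \<beta>) (a \<beta> + 1) * (\<Prod>i=1..j. Q i \<beta> ^ n \<beta> i)"
  define f where "f = ?f \<alpha> * (\<Prod>\<beta>\<in>-{\<alpha>}. Q (Suc 0) \<beta> * ?f \<beta>)"
  have "gen_fun C n j a b = Q (Suc 0) \<alpha> * f"
    unfolding gen_fun_def f_def by (subst prod.remove[of _ \<alpha>]) (auto simp: Compl_eq_Diff_UNIV mult_ac)
  then have nth: "fps_nth (gen_fun C n j a b) d = monom (axis \<alpha> (- 1)) * fps_nth f d" by simp
  have "ipow (Q i \<beta>) c \<in> nonpos_series \<alpha>" if "\<beta> \<noteq> \<alpha>" for i \<beta> c
    using that by (intro nonpos_series_ipow[OF qsys_nonpos qsys_nth_0]) (auto simp: axis_def)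
  moreover have "ipow (Q i \<alpha>) c \<in> nonpos_series \<alpha>" if "0 \<le> c" for i c
    using that by (simp add: ipow_def nonpos_series_power qsys_nonpos)
  ultimately have "f \<in> nonpos_series \<alpha>"
    unfolding f_def using assms(1)[of \<alpha>] assms(2)
    by (intro nonpos_series_intros qsys_nonpos) auto
  then have f: "fps_nth f d \<in> nonpos_poly \<alpha>" by (simp add: nonpos_series_def)
  have "e \<notin> Poly_Mapping.keys (monom (axis \<alpha> (- 1)) * fps_nth f d)"
  proof
    assume "e \<in> Poly_Mapping.keys (monom (axis \<alpha> (- 1)) * fps_nth f d)"
    then obtain p r where "p \<in> Poly_Mapping.keys (monom (axis \<alpha> (- 1)))" "r \<in> Poly_Mapping.keys (fps_nth f d)"
      "e = p + r" using keys_mult by blast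
    then show False using f assms(3) by (auto simp: monom_def axis_def nonpos_poly_def)
  qed
  then show ?thesis by (simp add: nth in_keys_iff)
qed

end

section \<open>The numbers \<open>q_part\<close>, their three-term recursion, and sums level by
  level\<close>

lemma q_part_eq:
  "q_part C l n k m \<alpha> i = int (l \<alpha>) + (\<Sum>s=1..k. int (s - i) *
     ((\<Sum>\<beta>\<in>UNIV. C \<alpha> \<beta> * int (m \<beta> s)) - int (n \<alpha> s)))"
proof -
  define D where "D s = (\<Sum>\<beta>\<in>UNIV. C \<alpha> \<beta> * int (m \<beta> s)) - int (n \<alpha> s)" for s
  have "(\<Sum>\<beta>\<in>UNIV. C \<alpha> \<beta> * int (m \<beta> s) - (if \<alpha> = \<beta> then int (n \<beta> s) else 0)) = D s" for s
    by (simp add: D_def sum_subtractf)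
  then have "q_part C l n k m \<alpha> i = int (l \<alpha>) + (\<Sum>j=1..k-i. int j * D (i + j))"
    by (simp add: q_part_def flip: sum_distrib_left)
  also have "(\<Sum>j=1..k-i. int j * D (i + j)) = (\<Sum>s\<in>{i+1..k}. int (s - i) * D s)"
    by (rule sum.reindex_bij_witness[of _ "\<lambda>s. s - i" "\<lambda>j. i + j"]) auto
  \<comment> \<open>Truncated subtraction kills the terms with \<open>s \<le> i\<close>, so all
    levels \<open>i\<close> share one range of summation.\<close>
  also have "\<dots> = (\<Sum>s=1..k. int (s - i) * D s)"
    by (rule sum.mono_neutral_left) auto
  finally show ?thesis by (simp add: D_def)
qed

lemma q_tot_eq: "q_tot C l n k m \<alpha> = q_part C l n k m \<alpha> 0"
  by (simp only: q_tot_def q_part_def add_0 diff_zero)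

text \<open>This triangularity allows level by level summation: fixing the levels above
  \<open>i\<close> fixes \<open>q\<^sub>i\<close>.\<close>

lemma q_part_cong:
  assumes "\<And>\<beta> s. i < s \<Longrightarrow> s \<le> k \<Longrightarrow> m \<beta> s = m' \<beta> s"
  shows "q_part C l n k m \<alpha> i = q_part C l n k m' \<alpha> i"
  unfolding q_part_eq
proof (intro arg_cong2[of _ _ _ _ "(+)"] sum.cong refl)
  fix s assume "s \<in> {1..k}"
  then show "int (s - i) * ((\<Sum>\<beta>\<in>UNIV. C \<alpha> \<beta> * int (m \<beta> s)) - int (n \<alpha> s))
      = int (s - i) * ((\<Sum>\<beta>\<in>UNIV. C \<alpha> \<beta> * int (m' \<beta> s)) - int (n \<alpha> s))"
    using assms by (cases "i < s") auto
qed

text \<open>As a function of \<open>j\<close>, the truncated difference \<open>s - j\<close> has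
  second difference 1 at \<open>s = Suc j\<close> and 0 elsewhere.\<close>

lemma q_part_rec:
  assumes "Suc j \<le> k"
  shows "q_part C l n k m \<alpha> j = 2 * q_part C l n k m \<alpha> (Suc j) - q_part C l n k m \<alpha> (Suc (Suc j))
    + (\<Sum>\<beta>\<in>UNIV. C \<alpha> \<beta> * int (m \<beta> (Suc j))) - int (n \<alpha> (Suc j))"
proof -
  define D where "D s = (\<Sum>\<beta>\<in>UNIV. C \<alpha> \<beta> * int (m \<beta> s)) - int (n \<alpha> s)" for s
  have "(\<Sum>s=1..k. int (s - j) * D s) = (\<Sum>s=1..k. 2 * (int (s - Suc j) * D s)
      - int (s - Suc (Suc j)) * D s + (if s = Suc j then D s else 0))"
  proof (rule sum.cong[OF refl])
    fix s
    have eq: "int (s - j) = 2 * int (s - Suc j) - int (s - Suc (Suc j)) + (if s = Suc j then 1 else 0)"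
      by auto
    show "int (s - j) * D s = 2 * (int (s - Suc j) * D s)
        - int (s - Suc (Suc j)) * D s + (if s = Suc j then D s else 0)"
      unfolding eq by (simp add: algebra_simps)
  qed
  also have "\<dots> = 2 * (\<Sum>s=1..k. int (s - Suc j) * D s) - (\<Sum>s=1..k. int (s - Suc (Suc j)) * D s) + D (Suc j)"
    using assms by (simp add: sum.distrib sum_subtractf sum_distrib_left)
  finally show ?thesis by (simp add: q_part_eq flip: D_def)
qed

text \<open>At level \<open>k + 1\<close> this starts the descent with nonnegative values, the
  weight being dominant.\<close>

lemma q_part_top: "k \<le> i \<Longrightarrow> q_part C l n k m \<alpha> i = int (l \<alpha>)"
  by (simp add: q_part_def)

text \<open>With \<open>P\<close> true, this is the index set of the coefficient of \<open>X\<^sup>d u\<^sup>e\<close> in \<open>gen_fun\<close>; \<open>m0\<close> fixes the levels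
  above \<open>j\<close>.\<close>

definition lower_range :: "(('r \<Rightarrow> int) \<Rightarrow> bool) \<Rightarrow> ('r::finite \<Rightarrow> 'r \<Rightarrow> int) \<Rightarrow> ('r \<Rightarrow> nat) \<Rightarrow>
    ('r \<Rightarrow> nat \<Rightarrow> nat) \<Rightarrow> nat \<Rightarrow> nat \<Rightarrow> ('r \<Rightarrow> nat \<Rightarrow> nat) \<Rightarrow> nat \<Rightarrow> ('r \<Rightarrow> int) \<Rightarrow>
    ('r \<Rightarrow> nat \<Rightarrow> nat) set" where
  "lower_range P C l n k j m0 d e = {m. (\<forall>\<alpha> i. i \<notin> {1..j} \<longrightarrow> m \<alpha> i = m0 \<alpha> i)
     \<and> (\<forall>i\<in>{1..j}. P (\<lambda>\<alpha>. q_part C l n k m \<alpha> i))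
     \<and> (\<Sum>i=1..j. i * (\<Sum>\<alpha>\<in>UNIV. m \<alpha> i)) = d \<and> (\<lambda>\<alpha>. q_part C l n k m \<alpha> 0) = e}"

definition weight :: "('r::finite \<Rightarrow> 'r \<Rightarrow> int) \<Rightarrow> ('r \<Rightarrow> nat) \<Rightarrow> ('r \<Rightarrow> nat \<Rightarrow> nat) \<Rightarrow> nat \<Rightarrow> nat \<Rightarrow>
    ('r \<Rightarrow> nat \<Rightarrow> nat) \<Rightarrow> int" where
  "weight C l n k j m = (\<Prod>i=1..j. \<Prod>\<alpha>\<in>UNIV. binom (m \<alpha> i) (q_part C l n k m \<alpha> i))"

abbreviation set_level :: "('r \<Rightarrow> nat \<Rightarrow> nat) \<Rightarrow> nat \<Rightarrow> ('r \<Rightarrow> nat) \<Rightarrow> 'r \<Rightarrow> nat \<Rightarrow> nat" where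
  "set_level m j \<mu> \<equiv> \<lambda>\<alpha>. (m \<alpha>)(j := \<mu> \<alpha>)"

lemma finite_bounded_functions: "finite {\<mu> :: 'r::finite \<Rightarrow> nat. \<forall>\<alpha>. \<mu> \<alpha> \<le> N}"
proof -
  have "{\<mu> :: 'r \<Rightarrow> nat. \<forall>\<alpha>. \<mu> \<alpha> \<le> N} = (\<Pi>\<^sub>E \<alpha>\<in>(UNIV :: 'r set). {..N})" by (auto simp: PiE_UNIV_domain)
  then show ?thesis by (simp add: finite_PiE)
qed

lemma level_le_degree:
  fixes m :: "'r::finite \<Rightarrow> nat \<Rightarrow> nat"
  assumes "i \<in> {1..j}"
  shows "m \<alpha> i \<le> (\<Sum>i=1..j. i * (\<Sum>\<alpha>\<in>UNIV. m \<alpha> i))"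
proof -
  have "m \<alpha> i \<le> (\<Sum>\<alpha>\<in>UNIV. m \<alpha> i)" by (rule member_le_sum) auto
  also have "\<dots> \<le> i * (\<Sum>\<alpha>\<in>UNIV. m \<alpha> i)" using assms by simp
  also have "\<dots> \<le> (\<Sum>i=1..j. i * (\<Sum>\<alpha>\<in>UNIV. m \<alpha> i))" by (rule member_le_sum) (use assms in auto)
  finally show ?thesis .
qed

lemma finite_lower_range:
  fixes C :: "'r::finite \<Rightarrow> 'r \<Rightarrow> int"
  shows "finite (lower_range P C l n k j m0 d e)"
proof -
  define f where "f g = (\<lambda>\<alpha> i. if i \<in> {1..j} then g (\<alpha>, i) else m0 \<alpha> i)" for g :: "'r \<times> nat \<Rightarrow> nat"
  have "lower_range P C l n k j m0 d e \<subseteq> f ` (\<Pi>\<^sub>E x\<in>UNIV \<times> {1..j}. {..d})"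
  proof
    fix m assume m: "m \<in> lower_range P C l n k j m0 d e"
    then have "m = f (restrict (\<lambda>(\<alpha>, i). m \<alpha> i) (UNIV \<times> {1..j}))"
      by (auto simp: f_def lower_range_def fun_eq_iff)
    moreover have "m \<alpha> i \<le> d" if "i \<in> {1..j}" for \<alpha> i
      using level_le_degree[OF that, of m \<alpha>] m by (simp only: lower_range_def mem_Collect_eq)
    then have "restrict (\<lambda>(\<alpha>, i). m \<alpha> i) (UNIV \<times> {1..j}) \<in> (\<Pi>\<^sub>E x\<in>UNIV \<times> {1..j}. {..d})"
      by (intro restrict_PiE_iff[THEN iffD2]) auto
    ultimately show "m \<in> f ` (\<Pi>\<^sub>E x\<in>UNIV \<times> {1..j}. {..d})" by blast
  qed
  then show ?thesis by (rule finite_subset) (intro finite_imageI finite_PiE, auto)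
qed

text \<open>The sum is split by the values \<mu> at level \<open>Suc j\<close>. The condition and
  the binomials at that level depend only on \<open>m0\<close> and \<mu>, so they leave the inner
  sum, which keeps the remaining degree.\<close>

lemma lower_sum_Suc:
  fixes C :: "'r::finite \<Rightarrow> 'r \<Rightarrow> int" and l :: "'r \<Rightarrow> nat" and n m0 :: "'r \<Rightarrow> nat \<Rightarrow> nat" and j k :: nat
  defines "b \<equiv> \<lambda>\<alpha>. q_part C l n k m0 \<alpha> (Suc j)"
  shows "(\<Sum>m\<in>lower_range P C l n k (Suc j) m0 d e. weight C l n k (Suc j) m)
    = (if P b then \<Sum>\<mu> | \<forall>\<alpha>. \<mu> \<alpha> \<le> d. (\<Prod>\<alpha>\<in>UNIV. binom (\<mu> \<alpha>) (b \<alpha>)) *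
        (if Suc j * (\<Sum>\<alpha>\<in>UNIV. \<mu> \<alpha>) \<le> d
         then \<Sum>m\<in>lower_range P C l n k j (set_level m0 (Suc j) \<mu>) (d - Suc j * (\<Sum>\<alpha>\<in>UNIV. \<mu> \<alpha>)) e.
           weight C l n k j m else 0) else 0)"
proof -
  let ?L = "lower_range P C l n k (Suc j) m0 d e"
  define g where "g m = (\<lambda>\<alpha>. m \<alpha> (Suc j))" for m :: "'r \<Rightarrow> nat \<Rightarrow> nat"
  have b: "(\<lambda>\<alpha>. q_part C l n k m \<alpha> (Suc j)) = b" if "m \<in> ?L" for m
    unfolding b_def using that by (intro ext q_part_cong) (auto simp: lower_range_def)
  have fib: "{m\<in>?L. g m = \<mu>} = (if P b \<and> Suc j * (\<Sum>\<alpha>\<in>UNIV. \<mu> \<alpha>) \<le> d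
      then lower_range P C l n k j (set_level m0 (Suc j) \<mu>) (d - Suc j * (\<Sum>\<alpha>\<in>UNIV. \<mu> \<alpha>)) e else {})"
    (is "_ = (if ?c then ?R else {})") for \<mu>
  proof (intro set_eqI iffI)
    fix m assume "m \<in> {m\<in>?L. g m = \<mu>}"
    then have m: "m \<in> ?L" "\<And>\<alpha>. m \<alpha> (Suc j) = \<mu> \<alpha>" by (auto simp: g_def)
    then have "P b" using b[OF m(1)] by (auto simp: lower_range_def)
    moreover have "(\<Sum>i=1..j. i * (\<Sum>\<alpha>\<in>UNIV. m \<alpha> i)) + Suc j * (\<Sum>\<alpha>\<in>UNIV. \<mu> \<alpha>) = d"
      using m by (simp add: lower_range_def)
    ultimately show "m \<in> (if ?c then ?R else {})"
      using m by (auto simp: lower_range_def)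
  next
    fix m assume "m \<in> (if ?c then ?R else {})"
    then have c: ?c and m: "m \<in> ?R" by (auto split: if_splits)
    have \<mu>: "m \<alpha> (Suc j) = \<mu> \<alpha>" for \<alpha> using m by (simp add: lower_range_def)
    have m0: "m \<alpha> i = m0 \<alpha> i" if "i \<notin> {1..Suc j}" for \<alpha> i
      using m that by (auto simp: lower_range_def)
    have "(\<lambda>\<alpha>. q_part C l n k m \<alpha> (Suc j)) = b"
      unfolding b_def by (intro ext q_part_cong m0) auto
    then have "P (\<lambda>\<alpha>. q_part C l n k m \<alpha> i)" if "i \<in> {1..Suc j}" for i
      using c m that by (cases "i = Suc j") (auto simp: lower_range_def)
    moreover have "(\<Sum>i=1..Suc j. i * (\<Sum>\<alpha>\<in>UNIV. m \<alpha> i)) = d"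
      using c m by (simp add: lower_range_def \<mu>)
    moreover have "(\<lambda>\<alpha>. q_part C l n k m \<alpha> 0) = e" using m by (simp add: lower_range_def)
    ultimately show "m \<in> {m\<in>?L. g m = \<mu>}"
      using m0 \<mu> by (auto simp: lower_range_def g_def)
  qed
  have "(\<Sum>m\<in>?L. weight C l n k (Suc j) m)
      = (\<Sum>\<mu> | \<forall>\<alpha>. \<mu> \<alpha> \<le> d. \<Sum>m\<in>{m\<in>?L. g m = \<mu>}. weight C l n k (Suc j) m)"
  proof (rule sum.group[symmetric, OF finite_lower_range finite_bounded_functions])
    show "g ` ?L \<subseteq> {\<mu>. \<forall>\<alpha>. \<mu> \<alpha> \<le> d}"
      using level_le_degree[of "Suc j" "Suc j"] by (auto simp: g_def lower_range_def)
  qed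
  also have "\<dots> = (\<Sum>\<mu> | \<forall>\<alpha>. \<mu> \<alpha> \<le> d. \<Sum>m\<in>{m\<in>?L. g m = \<mu>}.
      (\<Prod>\<alpha>\<in>UNIV. binom (\<mu> \<alpha>) (b \<alpha>)) * weight C l n k j m)"
  proof (intro sum.cong refl)
    fix \<mu> m assume "m \<in> {m\<in>?L. g m = \<mu>}"
    then have "g m = \<mu>" and m: "m \<in> ?L" by auto
    then have "m \<alpha> (Suc j) = \<mu> \<alpha>" for \<alpha> by (auto simp: g_def)
    then show "weight C l n k (Suc j) m = (\<Prod>\<alpha>\<in>UNIV. binom (\<mu> \<alpha>) (b \<alpha>)) * weight C l n k j m"
      using fun_cong[OF b[OF m]] by (simp add: weight_def mult.commute)
  qed
  also have "\<dots> = (\<Sum>\<mu> | \<forall>\<alpha>. \<mu> \<alpha> \<le> d. (\<Prod>\<alpha>\<in>UNIV. binom (\<mu> \<alpha>) (b \<alpha>)) *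
      (\<Sum>m\<in>{m\<in>?L. g m = \<mu>}. weight C l n k j m))"
    by (simp add: sum_distrib_left)
  finally show ?thesis
    unfolding fib by (auto intro: sum.cong)
qed

context cartan_like begin

text \<open>Both sides obey the same recursion in \<open>j\<close>, by \<open>lower_sum_Suc\<close>
  and \<open>gen_fun_Suc\<close>; \<open>m0\<close> varies because each step fixes one more
  level.\<close>

lemma lower_sum_unrestricted:
  assumes "j \<le> k"
  shows "(\<Sum>m\<in>lower_range (\<lambda>_. True) C l n k j m0 d e. weight C l n k j m)
    = Poly_Mapping.lookup (fps_nth (gen_fun C n j (\<lambda>\<alpha>. q_part C l n k m0 \<alpha> (Suc j))
        (\<lambda>\<alpha>. q_part C l n k m0 \<alpha> j)) d) e"
  using assms
proof (induction j arbitrary: m0 d)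
  case 0
  have "lower_range (\<lambda>_. True) C l n k 0 m0 d e
      = (if d = 0 \<and> (\<lambda>\<alpha>. q_part C l n k m0 \<alpha> 0) = e then {m0} else {})"
  proof -
    have "(\<forall>\<alpha> i. m \<alpha> i = m0 \<alpha> i) \<longleftrightarrow> m = m0" for m by (auto simp: fun_eq_iff)
    then show ?thesis by (auto simp: lower_range_def)
  qed
  then show ?case
    by (auto simp: gen_fun_0 monom_def weight_def lookup_single when_def)
next
  case (Suc j)
  define a where "a = (\<lambda>\<alpha>. q_part C l n k m0 \<alpha> (Suc (Suc j)))"
  define b where "b = (\<lambda>\<alpha>. q_part C l n k m0 \<alpha> (Suc j))"
  define b' where "b' \<mu> = (\<lambda>\<alpha>. 2 * b \<alpha> - a \<alpha> + (\<Sum>\<beta>\<in>UNIV. C \<alpha> \<beta> * int (\<mu> \<beta>)) - int (n \<alpha> (Suc j)))" for \<mu>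
  have b: "(\<lambda>\<alpha>. q_part C l n k (set_level m0 (Suc j) \<mu>) \<alpha> (Suc j)) = b" for \<mu>
    unfolding b_def by (intro ext q_part_cong) auto
  have a: "(\<lambda>\<alpha>. q_part C l n k (set_level m0 (Suc j) \<mu>) \<alpha> (Suc (Suc j))) = a" for \<mu>
    unfolding a_def by (intro ext q_part_cong) auto
  have b': "(\<lambda>\<alpha>. q_part C l n k (set_level m0 (Suc j) \<mu>) \<alpha> j) = b' \<mu>" for \<mu>
    unfolding b'_def by (rule ext, subst q_part_rec[OF Suc.prems])
      (simp add: fun_cong[OF a] fun_cong[OF b])
  \<comment> \<open>Taking \<open>N = d\<close> gives a congruence modulo
    \<open>fps_X ^ Suc d\<close>, just enough for coefficient \<open>d\<close>.\<close>
  have "fps_nth ((\<Sum>\<mu> | \<forall>\<alpha>. \<mu> \<alpha> \<le> d. of_int (\<Prod>\<alpha>\<in>UNIV. binom (\<mu> \<alpha>) (b \<alpha>))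
     * (fps_X ^ (Suc j * (\<Sum>\<alpha>\<in>UNIV. \<mu> \<alpha>)) * gen_fun C n j b (b' \<mu>))) - gen_fun C n (Suc j) a b) d = 0"
    unfolding b'_def by (rule X_power_dvd_nth[OF gen_fun_Suc]) simp
  then have nth: "fps_nth (gen_fun C n (Suc j) a b) d = fps_nth (\<Sum>\<mu> | \<forall>\<alpha>. \<mu> \<alpha> \<le> d.
      of_int (\<Prod>\<alpha>\<in>UNIV. binom (\<mu> \<alpha>) (b \<alpha>))
      * (fps_X ^ (Suc j * (\<Sum>\<alpha>\<in>UNIV. \<mu> \<alpha>)) * gen_fun C n j b (b' \<mu>))) d"
    by (simp only: fps_sub_nth right_minus_eq)
  have "Poly_Mapping.lookup (fps_nth (gen_fun C n (Suc j) a b) d) e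
      = (\<Sum>\<mu> | \<forall>\<alpha>. \<mu> \<alpha> \<le> d. (\<Prod>\<alpha>\<in>UNIV. binom (\<mu> \<alpha>) (b \<alpha>)) *
         Poly_Mapping.lookup (fps_nth (fps_X ^ (Suc j * (\<Sum>\<alpha>\<in>UNIV. \<mu> \<alpha>)) * gen_fun C n j b (b' \<mu>)) d) e)"
    unfolding nth fps_sum_nth lookup_sum fps_of_int_mult_nth lookup_of_int_mult ..
  also have "\<dots> = (\<Sum>m\<in>lower_range (\<lambda>_. True) C l n k (Suc j) m0 d e. weight C l n k (Suc j) m)"
    unfolding lower_sum_Suc if_True
  proof (intro sum.cong refl arg_cong2[of _ _ _ _ "(*)"])
    fix \<mu> :: "'r \<Rightarrow> nat"
    show "Poly_Mapping.lookup (fps_nth (fps_X ^ (Suc j * (\<Sum>\<alpha>\<in>UNIV. \<mu> \<alpha>)) * gen_fun C n j b (b' \<mu>)) d) e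
      = (if Suc j * (\<Sum>\<alpha>\<in>UNIV. \<mu> \<alpha>) \<le> d
         then \<Sum>m\<in>lower_range (\<lambda>_. True) C l n k j (set_level m0 (Suc j) \<mu>)
           (d - Suc j * (\<Sum>\<alpha>\<in>UNIV. \<mu> \<alpha>)) e. weight C l n k j m else 0)"
      using Suc.prems by (simp add: Suc.IH b b' fps_X_power_mult_nth not_le del: mult_Suc fun_upd_apply)
  qed (simp add: b_def)
  finally show ?case by (simp add: a_def b_def)
qed

text \<open>Descent from the top level. If \<open>q\<^sub>j\<^sub>+\<^sub>1\<close> has a negative
  entry, the unrestricted sum vanishes by \<open>gen_fun_vanishes\<close> and the restricted one is
  empty; otherwise level \<open>Suc j\<close> is fixed and the induction hypothesis applies below
  it.\<close>

lemma lower_sum_restricted: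
  assumes "j \<le> k" "\<And>\<alpha>. 0 \<le> q_part C l n k m0 \<alpha> (Suc j)" "\<And>\<alpha>. 0 \<le> e \<alpha>"
  shows "(\<Sum>m\<in>lower_range (\<lambda>_. True) C l n k j m0 d e. weight C l n k j m)
    = (\<Sum>m\<in>lower_range (\<lambda>b. \<forall>\<alpha>. 0 \<le> b \<alpha>) C l n k j m0 d e. weight C l n k j m)"
  using assms(1,2)
proof (induction j arbitrary: m0 d)
  case 0
  then show ?case by (simp add: lower_range_def)
next
  case (Suc j)
  define b where "b = (\<lambda>\<alpha>. q_part C l n k m0 \<alpha> (Suc j))"
  show ?case
  proof (cases "\<forall>\<alpha>. 0 \<le> b \<alpha>")
    case False
    then obtain \<alpha> where "b \<alpha> < 0" by (auto simp: not_le)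
    then have "(\<Sum>m\<in>lower_range (\<lambda>_. True) C l n k (Suc j) m0 d e. weight C l n k (Suc j) m) = 0"
      unfolding lower_sum_unrestricted[OF Suc.prems(1)] b_def[symmetric]
      using Suc.prems(2) assms(3) by (simp add: gen_fun_vanishes[of _ _ \<alpha>])
    moreover have "(\<Sum>m\<in>lower_range (\<lambda>b. \<forall>\<alpha>. 0 \<le> b \<alpha>) C l n k (Suc j) m0 d e. weight C l n k (Suc j) m) = 0"
      unfolding lower_sum_Suc using False by (simp only: b_def if_False)
    ultimately show ?thesis by simp
  next
    case True
    have "q_part C l n k (set_level m0 (Suc j) \<mu>) \<alpha> (Suc j) = b \<alpha>" for \<mu> \<alpha>
      unfolding b_def by (intro q_part_cong) auto
    then have "(\<Sum>m\<in>lower_range (\<lambda>_. True) C l n k j (set_level m0 (Suc j) \<mu>) d' e. weight C l n k j m)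
      = (\<Sum>m\<in>lower_range (\<lambda>b. \<forall>\<alpha>. 0 \<le> b \<alpha>) C l n k j (set_level m0 (Suc j) \<mu>) d' e. weight C l n k j m)"
      for \<mu> d' using Suc.prems(1) True by (intro Suc.IH) (simp_all del: fun_upd_apply)
    then show ?thesis
      using True unfolding lower_sum_Suc by (simp only: b_def if_True simp_thms)
  qed
qed

end

section \<open>Evaluation\<close>

text \<open>Additivity needs one index set for \<open>p\<close>, \<open>q\<close> and
  \<open>p + q\<close>, whose supports differ.\<close>

lemma eval_ones_poly_superset:
  assumes "finite S" "Poly_Mapping.keys p \<subseteq> S"
  shows "eval_ones_poly j p = (\<Sum>b\<in>S. of_int (Poly_Mapping.lookup p b) *
    (\<Prod>(\<alpha>, l)\<in>Poly_Mapping.keys b. if l < j then 1 else u_pow \<alpha> l (Poly_Mapping.lookup b (\<alpha>, l))))"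
  unfolding eval_ones_poly_def using assms
  by (intro sum.mono_neutral_left) (auto simp: in_keys_iff)

lemma eval_ones_poly_0: "eval_ones_poly j 0 = 0"
  by (simp add: eval_ones_poly_def)

lemma eval_ones_poly_add: "eval_ones_poly j (p + q) = eval_ones_poly j p + eval_ones_poly j q"
proof -
  define S where "S = Poly_Mapping.keys p \<union> Poly_Mapping.keys q"
  have "finite S" "Poly_Mapping.keys p \<subseteq> S" "Poly_Mapping.keys q \<subseteq> S" "Poly_Mapping.keys (p + q) \<subseteq> S"
    using keys_add[of p q] by (auto simp: S_def)
  note eval = this(2-4)[THEN eval_ones_poly_superset[OF this(1)]]
  show ?thesis
    unfolding eval by (simp only: lookup_add of_int_add distrib_right sum.distrib)
qed

lemma eval_ones_poly_sum: "eval_ones_poly j (\<Sum>i\<in>A. f i) = (\<Sum>i\<in>A. eval_ones_poly j (f i))"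
  by (induction A rule: infinite_finite_induct) (simp_all add: eval_ones_poly_0 eval_ones_poly_add)

lemma eval_ones_poly_single:
  assumes "\<And>\<alpha> l. (\<alpha>, l) \<in> Poly_Mapping.keys b \<Longrightarrow> l < j"
  shows "eval_ones_poly j (Poly_Mapping.single b c) = of_int c"
proof -
  have "(\<Prod>(\<alpha>, l)\<in>Poly_Mapping.keys b. if l < j then 1 else u_pow \<alpha> l (Poly_Mapping.lookup b (\<alpha>, l))) = 1"
    using assms by (intro prod.neutral) auto
  then show ?thesis by (subst eval_ones_poly_superset[of "{b}"]) auto
qed

lemma prod_single:
  "(\<Prod>i\<in>A. Poly_Mapping.single (f i) (c i)) = Poly_Mapping.single (\<Sum>i\<in>A. f i) (\<Prod>i\<in>A. c i)"
  for c :: "'i \<Rightarrow> int"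
  by (induction A rule: infinite_finite_induct) (simp_all add: mult_single)

text \<open>A summand is a single term in variables of level at most \<open>k\<close>, so only its
  coefficient survives.\<close>

lemma eval_ones_poly_summand:
  "eval_ones_poly (k + 1) (summand C l n k m)
    = of_int (\<Prod>i=1..k. \<Prod>\<alpha>\<in>UNIV. binom (m \<alpha> i) (q_part C l n k m \<alpha> i))"
proof -
  define b where "b = (\<Sum>\<alpha>\<in>UNIV. \<Sum>i=1..k. Poly_Mapping.single (\<alpha>, i) (q_part C l n k m \<alpha> i))"
  have factor: "of_int c * u_pow \<alpha> i e = Poly_Mapping.single (Poly_Mapping.single (\<alpha>, i) e) c" for c \<alpha> i e
    by (simp add: u_pow_def mult_single flip: single_of_int)
  have "summand C l n k m = Poly_Mapping.single b (\<Prod>\<alpha>\<in>UNIV. \<Prod>i=1..k. binom (m \<alpha> i) (q_part C l n k m \<alpha> i))"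
    unfolding summand_def factor prod_single b_def ..
  also have "(\<Prod>\<alpha>\<in>UNIV. \<Prod>i=1..k. binom (m \<alpha> i) (q_part C l n k m \<alpha> i))
      = (\<Prod>i=1..k. \<Prod>\<alpha>\<in>UNIV. binom (m \<alpha> i) (q_part C l n k m \<alpha> i))"
    by (rule prod.swap)
  finally have summand: "summand C l n k m
      = Poly_Mapping.single b (\<Prod>i=1..k. \<Prod>\<alpha>\<in>UNIV. binom (m \<alpha> i) (q_part C l n k m \<alpha> i))" .
  have "i < k + 1" if i: "(\<alpha>, i) \<in> Poly_Mapping.keys b" for \<alpha> i
  proof -
    obtain \<beta> where "(\<alpha>, i) \<in> Poly_Mapping.keys (\<Sum>i=1..k. Poly_Mapping.single (\<beta>, i) (q_part C l n k m \<beta> i))"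
      using subsetD[OF keys_sum i[unfolded b_def]] by (elim UN_E)
    from subsetD[OF keys_sum this] obtain i' where "i' \<in> {1..k}" "(\<alpha>, i) \<in> Poly_Mapping.keys (Poly_Mapping.single (\<beta>, i') (q_part C l n k m \<beta> i'))"
      by (elim UN_E)
    then show ?thesis by (auto split: if_splits)
  qed
  then show ?thesis
    unfolding summand by (rule eval_ones_poly_single)
qed

context cartan_like begin

text \<open>The total exponent depends on \<open>m\<close> only through \<open>C\<close> applied to
  the vector \<open>M m\<close>. Injectivity recovers \<open>M m\<close>, whose entries sum to the
  degree. So a coefficient of \<open>Z_full\<close> corresponds to a single power of
  \<open>fps_X\<close>.\<close>

lemma degree_determined:
  assumes inj: "\<And>x. (\<And>\<alpha>. (\<Sum>\<beta>\<in>UNIV. C \<alpha> \<beta> * x \<beta>) = 0) \<Longrightarrow> \<forall>\<beta>. x \<beta> = 0"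
    and q: "\<And>\<alpha>. q_part C l n k m \<alpha> 0 = q_part C l n k m' \<alpha> 0"
  shows "(\<Sum>i=1..k. i * (\<Sum>\<alpha>\<in>UNIV. m \<alpha> i)) = (\<Sum>i=1..k. i * (\<Sum>\<alpha>\<in>UNIV. m' \<alpha> i))"
proof -
  define M where "M m \<beta> = (\<Sum>i=1..k. int i * int (m \<beta> i))" for m :: "'r \<Rightarrow> nat \<Rightarrow> nat" and \<beta>
  have q_M: "q_part C l n k m \<alpha> 0
      = int (l \<alpha>) - (\<Sum>i=1..k. int i * int (n \<alpha> i)) + (\<Sum>\<beta>\<in>UNIV. C \<alpha> \<beta> * M m \<beta>)" for m \<alpha>
  proof -
    have "(\<Sum>i=1..k. int i * (\<Sum>\<beta>\<in>UNIV. C \<alpha> \<beta> * int (m \<beta> i)))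
        = (\<Sum>i=1..k. \<Sum>\<beta>\<in>UNIV. C \<alpha> \<beta> * (int i * int (m \<beta> i)))"
      by (simp add: sum_distrib_left mult.left_commute)
    also have "\<dots> = (\<Sum>\<beta>\<in>UNIV. C \<alpha> \<beta> * M m \<beta>)"
      unfolding M_def sum_distrib_left by (rule sum.swap)
    finally show ?thesis by (simp add: q_part_eq right_diff_distrib sum_subtractf)
  qed
  have "(\<Sum>\<beta>\<in>UNIV. C \<alpha> \<beta> * (M m \<beta> - M m' \<beta>)) = 0" for \<alpha>
    using q[of \<alpha>] unfolding q_M by (simp add: right_diff_distrib sum_subtractf)
  then have M: "M m \<beta> = M m' \<beta>" for \<beta> using inj[of "\<lambda>\<beta>. M m \<beta> - M m' \<beta>"] by simp
  have "int (\<Sum>i=1..k. i * (\<Sum>\<alpha>\<in>UNIV. m \<alpha> i)) = (\<Sum>\<beta>\<in>UNIV. M m \<beta>)" for m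
    unfolding M_def by (subst sum.swap) (simp add: sum_distrib_left)
  then show ?thesis using M by (metis (no_types, lifting) of_nat_eq_iff sum.cong)
qed

lemma PS_eval_ones_eq:
  assumes inj: "\<And>x. (\<And>\<alpha>. (\<Sum>\<beta>\<in>UNIV. C \<alpha> \<beta> * x \<beta>) = 0) \<Longrightarrow> \<forall>\<beta>. x \<beta> = 0"
  shows "PS (eval_ones (k + 1) (Z_full C l n k)) = PS (eval_ones (k + 1) (Z_restr (\<lambda>_. 1) C l n k))"
proof -
  have "eval_ones (k + 1) (Z_full C l n k) e = eval_ones (k + 1) (Z_restr (\<lambda>_. 1) C l n k) e"
    if e: "\<And>\<alpha>. 0 \<le> e \<alpha>" for e
  proof -
    let ?deg = "\<lambda>m :: 'r \<Rightarrow> nat \<Rightarrow> nat. \<Sum>i=1..k. i * (\<Sum>\<alpha>\<in>UNIV. m \<alpha> i)"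
    define A where "A = {m \<in> summation_range k. \<forall>\<alpha>. q_tot C l n k m \<alpha> = e \<alpha>}"
    \<comment> \<open>If no \<open>m\<close> has total exponent \<open>e\<close>, any
      \<open>d\<close> serves, as both index sets below are empty.\<close>
    obtain d where d: "\<And>m. m \<in> A \<Longrightarrow> ?deg m = d"
    proof (cases "A = {}")
      case True
      then show ?thesis by (intro that[of 0]) simp
    next
      case False
      then obtain m' where "m' \<in> A" by blast
      then have "?deg m = ?deg m'" if "m \<in> A" for m
        using that by (intro degree_determined[where l = l and n = n, OF inj]) (auto simp: A_def q_tot_eq)
      then show ?thesis by (rule that)
    qed
    have range: "{m. m \<in> summation_range k \<and> (\<forall>i\<in>{1..k}. P (\<lambda>\<alpha>. q_part C l n k m \<alpha> i))
        \<and> (\<forall>\<alpha>. q_tot C l n k m \<alpha> = e \<alpha>)} = lower_range P C l n k k (\<lambda>_ _. 0) d e" for P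
      using d by (auto simp: A_def lower_range_def summation_range_def q_tot_eq fun_eq_iff)
    have eval: "eval_ones (k + 1) (Z_restricted_to R C l n k) e
        = of_int (\<Sum>m\<in>lower_range P C l n k k (\<lambda>_ _. 0) d e. weight C l n k k m)"
      if "\<And>m. R m \<longleftrightarrow> (\<forall>i\<in>{1..k}. P (\<lambda>\<alpha>. q_part C l n k m \<alpha> i))" for R P
      unfolding eval_ones_def Z_restricted_to_def that range eval_ones_poly_sum eval_ones_poly_summand
      by (simp add: weight_def)
    show ?thesis
      unfolding Z_full_def Z_restr_def
      by (subst (1 2) eval[where P = "\<lambda>b. \<forall>\<alpha>. 0 \<le> b \<alpha>"] eval[where P = "\<lambda>_. True"])
        (auto simp: lower_sum_restricted q_part_top e)
  qed
  then show ?thesis by (auto simp: PS_def fun_eq_iff)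
qed

end

section \<open>Properties of the Cartan matrix\<close>

context complex_lie_algebra begin

lemma brk_add_right: "brk x (y + z) = brk x y + brk x z"
  using brk_linear_right[of x] by (simp add: linear_iff_module_hom module_hom_iff)

lemma brk_scale_right: "brk x (scale c y) = scale c (brk x y)"
  using brk_linear_right[of x] by (simp add: linear_iff_module_hom module_hom_iff)

lemma brk_add_left: "brk (x + y) z = brk x z + brk y z"
  using brk_linear_left[of z] by (simp add: linear_iff_module_hom module_hom_iff)

lemma brk_scale_left: "brk (scale c x) z = scale c (brk x z)"
  using brk_linear_left[of z] by (simp add: linear_iff_module_hom module_hom_iff)

lemma brk_zero_right: "brk x 0 = 0"
  using brk_add_right[of x 0 0] by simp

lemma brk_anticomm: "brk x y = - brk y x"
  using brk_self[of "x + y"] unfolding brk_add_left brk_add_right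
  by (simp add: brk_self eq_neg_iff_add_eq_0 add.commute)

lemma killing_form_add_left: "killing_form (x + y) z = killing_form x z + killing_form y z"
  by (simp add: killing_form_def trace_def brk_add_left representation_add independent_Basis span_Basis
      sum.distrib)

lemma killing_form_scale_left: "killing_form (scale c x) z = c * killing_form x z"
  by (simp add: killing_form_def trace_def brk_scale_left representation_scale independent_Basis span_Basis
      sum_distrib_left)

lemma killing_form_zero_left: "killing_form 0 z = 0"
  using killing_form_scale_left[of 0 0 z] by simp

lemma killing_form_sum_left:
  "killing_form (\<Sum>i\<in>A. scale (c i) (t i)) z = (\<Sum>i\<in>A. c i * killing_form (t i) z)"
  by (induction A rule: infinite_finite_induct)
    (simp_all add: killing_form_zero_left killing_form_add_left killing_form_scale_left)

text \<open>Commuting elements have commuting adjoint actions, so the cyclicity of the trace is not needed.\<close>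

lemma killing_form_commute:
  assumes "brk x y = 0"
  shows "killing_form x y = killing_form y x"
proof -
  have "brk x (brk y z) = brk y (brk x z)" for z
  proof -
    have "brk y (brk z x) = - brk y (brk x z)"
      using brk_anticomm[of z x] brk_scale_right[of y "- 1" "brk x z"] by (simp add: scale_minus_left)
    then show ?thesis using jacobi[of x y z] assms by (simp add: brk_zero_right)
  qed
  then show ?thesis by (simp add: killing_form_def)
qed

end

context simple_lie_algebra begin

lemma central_eq_0:
  assumes "\<And>x. brk h x = 0"
  shows "h = 0"
proof -
  let ?Z = "{y. \<forall>x. brk x y = 0}"
  have "lie_ideal ?Z"
    unfolding lie_ideal_def
    by (auto intro!: subspaceI simp: brk_zero_right brk_add_right brk_scale_right)
  then have "?Z = {0}" using no_proper_ideal non_abelian by blast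
  moreover have "h \<in> ?Z" using assms brk_anticomm[of _ h] by auto
  ultimately show ?thesis by blast
qed

text \<open>Every root is a combination of simple roots, so \<open>h\<close> acts as zero on all
  weight spaces. These span the algebra, hence \<open>h\<close> is central.\<close>

lemma roots_separate:
  fixes a :: "'r::finite \<Rightarrow> 'a \<Rightarrow> complex"
  assumes H: "cartan_subalgebra H" and a: "simple_roots H a" and h: "h \<in> H" "\<And>\<alpha>. a \<alpha> h = 0"
  shows "h = 0"
proof (rule central_eq_0)
  fix x
  have "x \<in> span (\<Union>\<mu>. weight_space H \<mu>)" using H by (auto simp: cartan_subalgebra_def)
  then show "brk h x = 0"
  proof (induction rule: span_induct_alt)
    case base
    show ?case by (rule brk_zero_right)
  next
    case (step c x y)
    then obtain \<mu> where \<mu>: "x \<in> weight_space H \<mu>" by auto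
    have "brk h x = 0"
    proof (cases "is_root H \<mu>")
      case True
      then obtain c :: "'r \<Rightarrow> nat" where "(\<forall>h\<in>H. \<mu> h = (\<Sum>\<alpha>\<in>UNIV. of_nat (c \<alpha>) * a \<alpha> h)) \<or>
          (\<forall>h\<in>H. \<mu> h = - (\<Sum>\<alpha>\<in>UNIV. of_nat (c \<alpha>) * a \<alpha> h))"
        using a unfolding simple_roots_def by blast
      then have "\<mu> h = 0" using h by auto
      then show ?thesis using \<mu> h by (simp add: weight_space_def)
    next
      case False
      then have "x = 0 \<or> \<mu> h = 0" using \<mu> h by (auto simp: is_root_def)
      then show ?thesis using \<mu> h by (auto simp: weight_space_def brk_zero_right)
    qed
    then show ?case using step by (simp add: brk_add_right brk_scale_right)
  qed
qed

text \<open>For injectivity, a kernel vector \<open>x\<close> gives the element \<open>h\<close> of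
  \<open>H\<close> with coordinates \<open>x\<close> in the \<open>t \<beta>\<close>. Up to a
  nonzero factor, row \<alpha> of the kernel equation is \<open>a \<alpha> h = 0\<close>, so
  \<open>h = 0\<close>; pairing \<open>h\<close> with \<open>H\<close> turns this into a linear
  relation among the simple roots.\<close>

lemma cartan_matrix_properties:
  assumes "is_cartan_matrix C"
  shows "C \<alpha> \<alpha> = 2" and "C \<alpha> \<beta> = 0 \<Longrightarrow> C \<beta> \<alpha> = 0"
    and "(\<And>\<alpha>. (\<Sum>\<beta>\<in>UNIV. C \<alpha> \<beta> * x \<beta>) = 0) \<Longrightarrow> x \<beta> = 0"
proof -
  obtain H a t where H: "cartan_subalgebra H" and a: "simple_roots H a"
    and t: "\<And>\<alpha>. t \<alpha> \<in> H" "\<And>\<alpha> h. h \<in> H \<Longrightarrow> killing_form (t \<alpha>) h = a \<alpha> h"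
    and nz: "\<And>\<alpha>. killing_form (t \<alpha>) (t \<alpha>) \<noteq> 0"
    and C: "\<And>\<alpha> \<beta>. of_int (C \<alpha> \<beta>) = 2 * killing_form (t \<alpha>) (t \<beta>) / killing_form (t \<alpha>) (t \<alpha>)"
    using assms unfolding is_cartan_matrix_def by metis
  have sym: "killing_form x y = killing_form y x" if "x \<in> H" "y \<in> H" for x y
    using H that unfolding cartan_subalgebra_def by (blast intro: killing_form_commute)
  show "C \<alpha> \<alpha> = 2" for \<alpha>
  proof -
    have "of_int (C \<alpha> \<alpha>) = (of_int 2 :: complex)" using C[of \<alpha> \<alpha>] nz[of \<alpha>] by simp
    then show ?thesis by (simp only: of_int_eq_iff)
  qed
  have C0: "C \<alpha> \<beta> = 0 \<longleftrightarrow> killing_form (t \<alpha>) (t \<beta>) = 0" for \<alpha> \<beta>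
    using C[of \<alpha> \<beta>] nz[of \<alpha>] by (metis divide_eq_0_iff mult_eq_0_iff of_int_0_eq_iff zero_neq_numeral)
  show "C \<alpha> \<beta> = 0 \<Longrightarrow> C \<beta> \<alpha> = 0" for \<alpha> \<beta>
    unfolding C0 using sym t(1) by simp
  assume x: "\<And>\<alpha>. (\<Sum>\<beta>\<in>UNIV. C \<alpha> \<beta> * x \<beta>) = 0"
  define h where "h = (\<Sum>\<beta>\<in>UNIV. scale (of_int (x \<beta>)) (t \<beta>))"
  have "subspace H" using H by (simp add: cartan_subalgebra_def)
  then have hH: "h \<in> H" unfolding h_def by (intro subspace_sum subspace_scale t(1))
  have "a \<alpha> h = 0" for \<alpha>
  proof -
    have "a \<alpha> h = killing_form h (t \<alpha>)" using t hH sym by metis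
    also have "\<dots> = (\<Sum>\<beta>\<in>UNIV. of_int (x \<beta>) * killing_form (t \<alpha>) (t \<beta>))"
      unfolding h_def killing_form_sum_left using sym t(1) by metis
    also have "\<dots> = (\<Sum>\<beta>\<in>UNIV. killing_form (t \<alpha>) (t \<alpha>) / 2 * of_int (C \<alpha> \<beta> * x \<beta>))"
      using nz[of \<alpha>] by (intro sum.cong refl) (simp add: C)
    also have "\<dots> = killing_form (t \<alpha>) (t \<alpha>) / 2 * of_int (\<Sum>\<beta>\<in>UNIV. C \<alpha> \<beta> * x \<beta>)"
      by (simp add: sum_distrib_left)
    finally show ?thesis by (simp add: x)
  qed
  then have "h = 0" using roots_separate H a hH by blast
  then have lin: "(\<Sum>\<beta>\<in>UNIV. of_int (x \<beta>) * a \<beta> y) = 0" if "y \<in> H" for y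
    using killing_form_sum_left[of "\<lambda>\<beta>. of_int (x \<beta>)" t UNIV y] killing_form_zero_left[of y] t(2)[OF that]
    by (simp add: h_def)
  have "of_int (x \<beta>) = (0 :: complex)"
    using a[unfolded simple_roots_def, THEN conjunct2, THEN conjunct1, rule_format, of "\<lambda>\<beta>. of_int (x \<beta>)"] lin
    by blast
  then show "x \<beta> = 0" by simp
qed

end

theorem theorem4p13:
  fixes scale :: "complex \<Rightarrow> 'g::ab_group_add \<Rightarrow> 'g"
    and B :: "'g set"
    and brk :: "'g \<Rightarrow> 'g \<Rightarrow> 'g"
    and C :: "'r::finite \<Rightarrow> 'r \<Rightarrow> int"
    and l :: "'r \<Rightarrow> nat"
    and n :: "'r \<Rightarrow> nat \<Rightarrow> nat"
    and k :: nat
  assumes "simple_lie_algebra scale B brk"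
    and "complex_lie_algebra.is_cartan_matrix scale B brk C"
    and "simply_laced C"
    and "1 \<le> k"
  shows "PS (eval_ones (k + 1) (Z_full C l n k)) =
         PS (eval_ones (k + 1) (Z_restr (\<lambda>_. 1) C l n k))"
proof -
  interpret simple_lie_algebra scale B brk by fact
  note C = cartan_matrix_properties[OF assms(2)]
  interpret cartan_like C
  proof
    show "C \<alpha> \<beta> \<le> 0" if "\<alpha> \<noteq> \<beta>" for \<alpha> \<beta>
      using assms(3) that unfolding simply_laced_def by fastforce
  qed (fact C(1), fact C(2))
  show ?thesis by (rule PS_eval_ones_eq) (blast intro: C(3))
qed

end
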